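(* Let $X$ be a Banach sequence space over $\mathbb{Z}$ in which $(e_n)_{n\in\mathbb{Z}}$ is a basis. Let $w=(w_n)_{n\in\mathbb{Z}}$ be a sequence of non-zero scalars such that the weighted backward shift $B_w$ is an operator on $X$, and define $v=(v_n)_{n\in\mathbb{Z}}$ by $$v_n=\frac{1}{w_1\cdots w_n}\ (n>0),\qquad v_0=1,\qquad v_n=w_{n+1}\cdots w_0\ (n<0).$$ Let $\mathcal{A}$ be a Furstenberg family. Consider the following condition. (C) For some sequence $(\varepsilon_p)_{p\geq1}$ of positive numbers tending to $0$ there is a sequence $(A_p)_{p\geq 1}$ of pairwise disjoint sets in $\mathcal{A}$ such that, for any $p,q\geq1$, any $m\in A_q$, and any $j=-p,\ldots,p$, $$\Big|\Big|\Big|\sum_{n\in A_p,\ n\neq m} v_{n-m+j}\,e_{n-m+j}\Big|\Big|\Big|<\min(\varepsilon_p,\varepsilon_q).$$ Then: 1. Condition (C) is equivalent to the condition obtained by replacing "for some sequence $(\varepsilon_p)$" with "for all sequences $(\varepsilon_p)$" (of positive numbers tending to $0$). 2. If (C) holds, then $B_w:\widehat{X}\to\widehat{X}$ is $\mathcal{A}$-hypercyclic for $X$. 3. If $(e_n)_{n\in\mathbb{Z}}$ is an unconditional basis in $X$, then the converse of 2 also holds. 4. If $B_w$ is invertible, then in (C) it suffices to require the displayed inequality for $j=0$ only.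
   Context: Scalars are real or complex ($\mathbb{K}=\mathbb{R}$ or $\mathbb{C}$). An operator on a Banach space is a continuous linear self-map. A Banach sequence space over $\mathbb{Z}$ is a Banach space $X$ that is a subspace of $\mathbb{K}^{\mathbb{Z}}$ such that each coordinate functional $(x_n)_{n\in\mathbb{Z}}\mapsto x_k$, $k\in\mathbb{Z}$, is continuous on $X$. The canonical unit sequences are $e_n=(\delta_{n,k})_{k\in\mathbb{Z}}$. That $(e_n)_{n\in\mathbb{Z}}$ is a basis of $X$ means that all $e_n$ lie in $X$ and every $x=(x_n)\in X$ satisfies $x=\lim_{m,n\to\infty}\sum_{-m\leq k\leq n}x_ke_k$ in $X$; it is unconditional if these series converge unconditionally. For any scalar sequence $x=(x_n)_{n\in\mathbb{Z}}$ put $|||x|||=\sup_{m,n\geq0}\big\|\sum_{-m\leq k\leq n}x_ke_k\big\|\in[0,\infty]$. On $X$ this is a norm equivalent to the original one. Let $\widehat{X}=\{x\in\mathbb{K}^{\mathbb{Z}}: |||x|||<\infty\}$, normed by $|||\cdot|||$; it is a Banach sequence space containing $X$ as a closed subspace. A (possibly non-convergent) formal series $\sum_{n}x_ne_n$ denotes the sequence $(x_n)$. The bilateral weighted backward shift is $B_w(x_n)_{n\in\mathbb{Z}}=(w_{n+1}x_{n+1})_{n\in\mathbb{Z}}$. If $B_w$ is an operator on $X$ it is also an operator on $\widehat{X}$, and it is invertible on $X$ if and only if it is invertible on $\widehat{X}$. A Furstenberg family is a non-empty family $\mathcal{A}$ of subsets of $\mathbb{N}_0$ such that $A\in\mathcal{A}$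 and $A\subset B\subset\mathbb{N}_0$ imply $B\in\mathcal{A}$. If $Z$ is a closed subspace of a Banach space $Y$, an operator $T$ on $Y$ is $\mathcal{A}$-hypercyclic for $Z$ if there is a vector $y\in Y$ such that, for any open subset $U$ of $Y$ with $U\cap Z\neq\varnothing$, one has $\{n\geq0: T^ny\in U\}\in\mathcal{A}$. *)

theory Defs
  imports "HOL-Analysis.Analysis" "HOL-Library.Function_Algebras"
begin

text \<open>
  Scalars are elements of a type of class \<open>{real_normed_field, euclidean_space}\<close>. Both
  \<^typ>\<open>real\<close> and \<^typ>\<open>complex\<close> belong to it, and up to isometric isomorphism there are
  no others, so a statement polymorphic in this class covers exactly these two cases.

  A sequence space is given by a carrier \<open>X\<close> inside \<open>int \<Rightarrow> 'k\<close> and a norm \<open>nrm\<close> on it;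
  the values of \<open>nrm\<close> outside \<open>X\<close> are irrelevant.
\<close>

definition seq_scale :: "'k::field \<Rightarrow> (int \<Rightarrow> 'k) \<Rightarrow> int \<Rightarrow> 'k" where
  "seq_scale c x = (\<lambda>i. c * x i)"

interpretation seqs: vector_space seq_scale
  by unfold_locales (auto simp: seq_scale_def algebra_simps fun_eq_iff)

definition unit_seq :: "int \<Rightarrow> int \<Rightarrow> 'k::field" where
  "unit_seq n = (\<lambda>k. if k = n then 1 else 0)"

definition normed_sequence_space ::
    "(int \<Rightarrow> 'k::{real_normed_field, euclidean_space}) set \<Rightarrow> ((int \<Rightarrow> 'k) \<Rightarrow> real) \<Rightarrow> bool" where
  "normed_sequence_space X nrm \<longleftrightarrow>
     seqs.subspace X \<and>
     (\<forall>x\<in>X. 0 \<le> nrm x) \<and>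
     (\<forall>x\<in>X. nrm x = 0 \<longleftrightarrow> x = 0) \<and>
     (\<forall>c. \<forall>x\<in>X. nrm (seq_scale c x) = norm c * nrm x) \<and>
     (\<forall>x\<in>X. \<forall>y\<in>X. nrm (x + y) \<le> nrm x + nrm y)"

text \<open>
  The locale \<^locale>\<open>Metric_space\<close> wants a distance that is symmetric and nonnegative also
  outside the carrier, hence the default value 0 there.
\<close>

definition seq_dist ::
    "(int \<Rightarrow> 'k::{real_normed_field, euclidean_space}) set \<Rightarrow> ((int \<Rightarrow> 'k) \<Rightarrow> real)
      \<Rightarrow> (int \<Rightarrow> 'k) \<Rightarrow> (int \<Rightarrow> 'k) \<Rightarrow> real" where
  "seq_dist X nrm x y = (if x \<in> X \<and> y \<in> X then nrm (x - y) else 0)"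

lemma Metric_space_seq_dist:
  assumes "normed_sequence_space X nrm"
  shows "Metric_space X (seq_dist X nrm)"
proof -
  have sub: "seqs.subspace X"
    and nn: "\<And>x. x \<in> X \<Longrightarrow> 0 \<le> nrm x"
    and z: "\<And>x. x \<in> X \<Longrightarrow> nrm x = 0 \<longleftrightarrow> x = 0"
    and sc: "\<And>c x. x \<in> X \<Longrightarrow> nrm (seq_scale c x) = norm c * nrm x"
    and tri: "\<And>x y. x \<in> X \<Longrightarrow> y \<in> X \<Longrightarrow> nrm (x + y) \<le> nrm x + nrm y"
    using assms unfolding normed_sequence_space_def by auto
  have diff: "x - y \<in> X" if "x \<in> X" "y \<in> X" for x y
    using seqs.subspace_diff[OF sub that] .
  show ?thesis
  proof
    fix x y show "0 \<le> seq_dist X nrm x y"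
      by (auto simp: seq_dist_def nn diff)
    have "nrm (x - y) = nrm (y - x)" if "x \<in> X" "y \<in> X"
    proof -
      have "x - y = seq_scale (- 1) (y - x)"
        by (simp add: seq_scale_def fun_eq_iff)
      then show ?thesis
        using sc[OF diff[OF that(2,1)], of "- 1"] by simp
    qed
    then show "seq_dist X nrm x y = seq_dist X nrm y x"
      by (simp add: seq_dist_def)
  next
    fix x y assume "x \<in> X" "y \<in> X"
    then show "(seq_dist X nrm x y = 0) = (x = y)"
      by (simp add: seq_dist_def z diff)
  next
    fix x y u assume "x \<in> X" "y \<in> X" "u \<in> X"
    then show "seq_dist X nrm x u \<le> seq_dist X nrm x y + seq_dist X nrm y u"
      using tri[of "x - y" "y - u"] by (simp add: seq_dist_def diff)
  qed
qed

abbreviation seq_topology ::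
    "(int \<Rightarrow> 'k::{real_normed_field, euclidean_space}) set \<Rightarrow> ((int \<Rightarrow> 'k) \<Rightarrow> real)
      \<Rightarrow> (int \<Rightarrow> 'k) topology" where
  "seq_topology X nrm \<equiv> Metric_space.mtopology X (seq_dist X nrm)"

definition banach_sequence_space ::
    "(int \<Rightarrow> 'k::{real_normed_field, euclidean_space}) set \<Rightarrow> ((int \<Rightarrow> 'k) \<Rightarrow> real) \<Rightarrow> bool" where
  "banach_sequence_space X nrm \<longleftrightarrow>
     normed_sequence_space X nrm \<and>
     Metric_space.mcomplete X (seq_dist X nrm) \<and>
     (\<forall>k. continuous_map (seq_topology X nrm) euclidean (\<lambda>x. x k))"

definition operator_on ::
    "(int \<Rightarrow> 'k::{real_normed_field, euclidean_space}) set \<Rightarrow> ((int \<Rightarrow> 'k) \<Rightarrow> real)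
      \<Rightarrow> ((int \<Rightarrow> 'k) \<Rightarrow> int \<Rightarrow> 'k) \<Rightarrow> bool" where
  "operator_on X nrm T \<longleftrightarrow>
     T ` X \<subseteq> X \<and>
     (\<forall>x\<in>X. \<forall>y\<in>X. T (x + y) = T x + T y) \<and>
     (\<forall>c. \<forall>x\<in>X. T (seq_scale c x) = seq_scale c (T x)) \<and>
     continuous_map (seq_topology X nrm) (seq_topology X nrm) T"

definition invertible_operator_on ::
    "(int \<Rightarrow> 'k::{real_normed_field, euclidean_space}) set \<Rightarrow> ((int \<Rightarrow> 'k) \<Rightarrow> real)
      \<Rightarrow> ((int \<Rightarrow> 'k) \<Rightarrow> int \<Rightarrow> 'k) \<Rightarrow> bool" where
  "invertible_operator_on X nrm T \<longleftrightarrow>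
     operator_on X nrm T \<and>
     (\<exists>S. operator_on X nrm S \<and> (\<forall>x\<in>X. S (T x) = x \<and> T (S x) = x))"

definition partial_sum :: "(int \<Rightarrow> 'k::field) \<Rightarrow> nat \<Rightarrow> nat \<Rightarrow> int \<Rightarrow> 'k" where
  "partial_sum x m n = (\<Sum>k\<in>{- int m..int n}. seq_scale (x k) (unit_seq k))"

definition unit_seqs_basis ::
    "(int \<Rightarrow> 'k::{real_normed_field, euclidean_space}) set \<Rightarrow> ((int \<Rightarrow> 'k) \<Rightarrow> real) \<Rightarrow> bool" where
  "unit_seqs_basis X nrm \<longleftrightarrow>
     (\<forall>n. unit_seq n \<in> X) \<and>
     (\<forall>x\<in>X. limitin (seq_topology X nrm) (\<lambda>(m, n). partial_sum x m n) x
               (sequentially \<times>\<^sub>F sequentially))"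

text \<open>
  Unconditional convergence of a series over the integers: for every enumeration of the
  index set the resulting ordinary series converges.
\<close>

definition unit_seqs_unconditional_basis ::
    "(int \<Rightarrow> 'k::{real_normed_field, euclidean_space}) set \<Rightarrow> ((int \<Rightarrow> 'k) \<Rightarrow> real) \<Rightarrow> bool" where
  "unit_seqs_unconditional_basis X nrm \<longleftrightarrow>
     unit_seqs_basis X nrm \<and>
     (\<forall>x\<in>X. \<forall>\<pi> :: nat \<Rightarrow> int. bij \<pi> \<longrightarrow>
        (\<exists>l. limitin (seq_topology X nrm)
                (\<lambda>N. \<Sum>i<N. seq_scale (x (\<pi> i)) (unit_seq (\<pi> i))) l sequentially))"

definition triple_norm :: "((int \<Rightarrow> 'k::field) \<Rightarrow> real) \<Rightarrow> (int \<Rightarrow> 'k) \<Rightarrow> ereal" where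
  "triple_norm nrm x = (SUP (m, n) \<in> UNIV. ereal (nrm (partial_sum x m n)))"

definition hat_space :: "((int \<Rightarrow> 'k::field) \<Rightarrow> real) \<Rightarrow> (int \<Rightarrow> 'k) set" where
  "hat_space nrm = {x. triple_norm nrm x < \<infinity>}"

definition hat_norm :: "((int \<Rightarrow> 'k::field) \<Rightarrow> real) \<Rightarrow> (int \<Rightarrow> 'k) \<Rightarrow> real" where
  "hat_norm nrm x = real_of_ereal (triple_norm nrm x)"

definition backward_shift :: "(int \<Rightarrow> 'k::field) \<Rightarrow> (int \<Rightarrow> 'k) \<Rightarrow> int \<Rightarrow> 'k" where
  "backward_shift w x = (\<lambda>n. w (n + 1) * x (n + 1))"

text \<open>For \<open>n = 0\<close> the second branch is an empty product, so the value is 1.\<close>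

definition shift_weights :: "(int \<Rightarrow> 'k::field) \<Rightarrow> int \<Rightarrow> 'k" where
  "shift_weights w n =
     (if n > 0 then 1 / (\<Prod>k\<in>{1..n}. w k) else (\<Prod>k\<in>{n + 1..0}. w k))"

definition furstenberg_family :: "nat set set \<Rightarrow> bool" where
  "furstenberg_family \<A> \<longleftrightarrow> \<A> \<noteq> {} \<and> (\<forall>A B. A \<in> \<A> \<and> A \<subseteq> B \<longrightarrow> B \<in> \<A>)"

definition hypercyclic_for ::
    "nat set set \<Rightarrow> (int \<Rightarrow> 'k::{real_normed_field, euclidean_space}) set \<Rightarrow> ((int \<Rightarrow> 'k) \<Rightarrow> real)
      \<Rightarrow> ((int \<Rightarrow> 'k) \<Rightarrow> int \<Rightarrow> 'k) \<Rightarrow> (int \<Rightarrow> 'k) set \<Rightarrow> bool" where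
  "hypercyclic_for \<A> Y nrm T Z \<longleftrightarrow>
     (\<exists>y\<in>Y. \<forall>U. openin (seq_topology Y nrm) U \<and> U \<inter> Z \<noteq> {} \<longrightarrow> {n. (T ^^ n) y \<in> U} \<in> \<A>)"

text \<open>
  The formal series of the terms \<open>v (n - m + j) e\<^bsub>n - m + j\<^esub>\<close> over \<open>n \<in> A - {m}\<close>, as a
  sequence. The map \<open>n \<mapsto> n - m + j\<close> is injective, so every index occurs at most once.
\<close>

definition shifted_series ::
    "(int \<Rightarrow> 'k::field) \<Rightarrow> nat set \<Rightarrow> nat \<Rightarrow> int \<Rightarrow> int \<Rightarrow> 'k" where
  "shifted_series v A m j =
     (\<lambda>k. if \<exists>n\<in>A. n \<noteq> m \<and> k = int n - int m + j then v k else 0)"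

definition null_positive :: "(nat \<Rightarrow> real) \<Rightarrow> bool" where
  "null_positive \<epsilon> \<longleftrightarrow> (\<forall>p\<ge>1. 0 < \<epsilon> p) \<and> \<epsilon> \<longlonglongrightarrow> 0"

text \<open>
  The condition for a fixed sequence \<open>\<epsilon>\<close>; \<open>J p\<close> is the set of shifts \<open>j\<close> for which the
  inequality is required. All sequences are indexed by \<open>p \<ge> 1\<close>, the value at 0 is ignored.
\<close>

definition small_series_condition ::
    "((int \<Rightarrow> 'k::field) \<Rightarrow> real) \<Rightarrow> (int \<Rightarrow> 'k) \<Rightarrow> nat set set \<Rightarrow> (nat \<Rightarrow> int set)
      \<Rightarrow> (nat \<Rightarrow> real) \<Rightarrow> bool" where
  "small_series_condition nrm v \<A> J \<epsilon> \<longleftrightarrow>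
     (\<exists>A :: nat \<Rightarrow> nat set.
        (\<forall>p\<ge>1. A p \<in> \<A>) \<and> disjoint_family_on A {1..} \<and>
        (\<forall>p\<ge>1. \<forall>q\<ge>1. \<forall>m\<in>A q. \<forall>j\<in>J p.
           triple_norm nrm (shifted_series v (A p) m j) < ereal (min (\<epsilon> p) (\<epsilon> q))))"

end

theory Submission
  imports Defs
begin

text \<open>
  In the coordinates given by the weights the shift is a plain translation: it maps
  \<open>v (n + 1) e\<^bsub>n + 1\<^esub>\<close> to \<open>v n e\<^bsub>n\<^esub>\<close>. So the orbit of \<open>y = \<Sum>n. y\<^sub>n v n e\<^bsub>n\<^esub>\<close> is close to a finite
  pattern at time \<open>m\<close> if the coefficients \<open>y\<^sub>n\<close> show this pattern around \<open>n = m\<close> and the rest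
  of the translated series is small.

  Suppose that the condition holds. The place where the pattern number \<open>p\<close> of a dense sequence
  of finite patterns is planted is the set \<open>A p\<close>; seen from a time \<open>m\<close> in \<open>A q\<close>, the patterns
  planted elsewhere contribute combinations of the series in the condition, and these are small
  if the tolerances are chosen after the patterns (\<open>hypercyclic_if_small_series\<close>). That the
  tolerances can be prescribed is seen by passing to a subsequence of the sets
  (\<open>small_series_condition_any_tolerance\<close>).

  Conversely, let \<open>y\<close> be a hypercyclic vector. Let \<open>A p\<close> be the set of times at which its orbit
  is very close to a pattern of length \<open>2 * p + 1\<close> whose coefficients are large integers that
  occur neither twice in it nor in the other patterns. Any coefficient of \<open>y\<close> in
  the window around such a time then betrays the pattern and the position within it, so that
  windows at distinct times do not overlap. At a time \<open>m\<close> in \<open>A q\<close> the part of the translated series outside the window is small.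
  The series in the condition is obtained from it by keeping some of the terms and dividing them
  by the known large coefficients; for an unconditional basis this is harmless
  (\<open>unconditional_multiplier_bound\<close>, which combines Baire's theorem with a rearrangement
  argument). This gives \<open>small_series_if_hypercyclic\<close>.

  If the shift is invertible, it and its inverse move the series for one \<open>j\<close> to those for
  the neighbouring \<open>j\<close>, and the powers of the norms that this costs are absorbed by the
  tolerances (\<open>small_series_condition_if_invertible\<close>).
\<close>

section \<open>Norms on spaces of two-sided sequences\<close>

lemma sum_seq_apply: "(\<Sum>i\<in>I. f i) k = (\<Sum>i\<in>I. f i k)" for f :: "'a \<Rightarrow> int \<Rightarrow> 'b::comm_monoid_add"
  by (induction I rule: infinite_finite_induct) auto

lemma seq_scale_apply: "seq_scale c x k = c * x k"
  by (simp add: seq_scale_def)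

lemma seq_diff_apply [simp]: "(x - y) k = x k - y k" for x y :: "int \<Rightarrow> 'b::group_add"
  by simp

locale seq_norm =
  fixes X :: "(int \<Rightarrow> 'k::{real_normed_field, euclidean_space}) set"
    and nrm :: "(int \<Rightarrow> 'k) \<Rightarrow> real"
  assumes normed: "normed_sequence_space X nrm"
begin

lemma subspace: "seqs.subspace X"
  using normed by (simp add: normed_sequence_space_def)

lemmas zero_in = seqs.subspace_0[OF subspace]
  and add_in = seqs.subspace_add[OF subspace]
  and diff_in = seqs.subspace_diff[OF subspace]
  and scale_in = seqs.subspace_scale[OF subspace]
  and sum_in = seqs.subspace_sum[OF subspace]

lemma nrm_nonneg: "x \<in> X \<Longrightarrow> 0 \<le> nrm x"
  using normed by (simp add: normed_sequence_space_def)

lemma nrm_eq_0: "x \<in> X \<Longrightarrow> nrm x = 0 \<longleftrightarrow> x = 0"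
  using normed by (simp add: normed_sequence_space_def)

lemma nrm_scale: "x \<in> X \<Longrightarrow> nrm (seq_scale c x) = norm c * nrm x"
  using normed by (simp add: normed_sequence_space_def)

lemma nrm_triangle: "x \<in> X \<Longrightarrow> y \<in> X \<Longrightarrow> nrm (x + y) \<le> nrm x + nrm y"
  using normed by (simp add: normed_sequence_space_def)

lemma nrm_0: "nrm 0 = 0"
  using nrm_eq_0[OF zero_in] by simp

lemma nrm_commute:
  assumes "x \<in> X" "y \<in> X"
  shows "nrm (x - y) = nrm (y - x)"
proof -
  have "x - y = seq_scale (- 1) (y - x)"
    by (simp add: fun_eq_iff seq_scale_apply)
  then show ?thesis
    using nrm_scale[OF diff_in[OF assms(2,1)], of "- 1"] by simp
qed

lemma nrm_diff_le:
  assumes "x \<in> X" "y \<in> X"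
  shows "nrm (x - y) \<le> nrm x + nrm y"
  using nrm_triangle[OF assms(1) diff_in[OF zero_in assms(2)]] nrm_commute[OF zero_in assms(2)]
  by simp

lemma nrm_sum_scale_le:
  assumes "\<And>i. i \<in> I \<Longrightarrow> f i \<in> X"
  shows "nrm (\<Sum>i\<in>I. seq_scale (c i) (f i)) \<le> (\<Sum>i\<in>I. norm (c i) * nrm (f i))"
  using assms
proof (induction I rule: infinite_finite_induct)
  case (insert i I)
  have "(\<Sum>i\<in>I. seq_scale (c i) (f i)) \<in> X" "seq_scale (c i) (f i) \<in> X"
    using insert.prems by (auto intro!: sum_in scale_in)
  from nrm_triangle[OF this(2,1)]
  have "nrm (\<Sum>i\<in>insert i I. seq_scale (c i) (f i))
      \<le> norm (c i) * nrm (f i) + nrm (\<Sum>i\<in>I. seq_scale (c i) (f i))"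
    unfolding sum.insert[OF insert.hyps] by (simp only: nrm_scale[OF insert.prems] insertI1)
  also have "\<dots> \<le> norm (c i) * nrm (f i) + (\<Sum>i\<in>I. norm (c i) * nrm (f i))"
    using insert.IH insert.prems by simp
  finally show ?case
    unfolding sum.insert[OF insert.hyps] .
qed (simp_all add: nrm_0)

lemma metric: "Metric_space X (seq_dist X nrm)"
  by (rule Metric_space_seq_dist[OF normed])

sublocale Metric_space X "seq_dist X nrm"
  by (rule metric)

lemma seq_dist_eq: "x \<in> X \<Longrightarrow> y \<in> X \<Longrightarrow> seq_dist X nrm x y = nrm (x - y)"
  by (simp add: seq_dist_def)

lemma mem_mball: "y \<in> mball x r \<longleftrightarrow> x \<in> X \<and> y \<in> X \<and> nrm (x - y) < r"
  by (auto simp: in_mball seq_dist_def)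

text \<open>
  Continuity at 0 together with homogeneity gives a bound: a vector of norm at most
  \<open>r / 2\<close>, where \<open>r\<close> is the radius belonging to the tolerance 1, has an image of size
  less than 1.
\<close>

lemma bounded_of_small:
  assumes r: "r > 0" and small: "\<And>x. x \<in> X \<Longrightarrow> nrm x < r \<Longrightarrow> g x < (1::real)"
    and hom: "\<And>c x. x \<in> X \<Longrightarrow> g (seq_scale c x) = norm c * g x"
    and x: "x \<in> X"
  shows "g x \<le> (2 / r) * nrm x"
proof (cases "x = 0")
  case True
  then show ?thesis
    using hom[OF x, of 0] nrm_0 by (simp add: seq_scale_def zero_fun_def)
next
  case False
  then have pos: "nrm x > 0"
    using nrm_eq_0[OF x] nrm_nonneg[OF x] by linarith
  define c :: 'k where "c = of_real (r / (2 * nrm x))"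
  have c: "norm c = r / (2 * nrm x)"
    using pos r unfolding c_def norm_of_real by simp
  have "nrm (seq_scale c x) < r"
    using pos r by (simp add: nrm_scale[OF x] c)
  from small[OF scale_in[OF x] this] have "r / (2 * nrm x) * g x < 1"
    by (simp add: hom[OF x] c)
  then show ?thesis
    using pos r by (simp add: field_simps)
qed

lemma operator_bounded:
  assumes "operator_on X nrm T"
  obtains K where "K \<ge> 1" "\<And>x. x \<in> X \<Longrightarrow> nrm (T x) \<le> K * nrm x"
proof -
  have into: "\<And>x. x \<in> X \<Longrightarrow> T x \<in> X"
    and hom: "\<And>c x. x \<in> X \<Longrightarrow> T (seq_scale c x) = seq_scale c (T x)"
    and cont: "continuous_map mtopology mtopology T"
    using assms by (auto simp: operator_on_def)
  have T0: "T 0 = 0"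
    using hom[OF zero_in, of 0] by (simp add: seq_scale_def zero_fun_def)
  obtain U where U: "openin mtopology U" "0 \<in> U" "\<forall>y\<in>U. T y \<in> mball (T 0) 1"
    using cont zero_in unfolding continuous_map_to_metric
    by (metis topspace_mtopology zero_less_one)
  then obtain r where r: "r > 0" "mball 0 r \<subseteq> U"
    by (auto simp: openin_mtopology)
  have small: "nrm (T x) < 1" if "x \<in> X" "nrm x < r" for x
  proof -
    have "x \<in> mball 0 r"
      using that zero_in nrm_commute[OF zero_in that(1)] unfolding mem_mball by simp
    then have "T x \<in> mball 0 1"
      using U r T0 by auto
    then show ?thesis
      using nrm_commute[OF zero_in into[OF that(1)]] unfolding mem_mball by simp
  qed
  have "nrm (T x) \<le> max 1 (2 / r) * nrm x" if "x \<in> X" for x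
  proof -
    have "nrm (T x) \<le> (2 / r) * nrm x"
      by (rule bounded_of_small[OF r(1)]) (simp_all add: small that hom into nrm_scale)
    also have "\<dots> \<le> max 1 (2 / r) * nrm x"
      using nrm_nonneg[OF that] by (intro mult_right_mono) auto
    finally show ?thesis .
  qed
  then show ?thesis
    by (intro that[of "max 1 (2 / r)"]) auto
qed

lemma coordinate_bounded:
  assumes "continuous_map mtopology euclidean (\<lambda>x. x k)"
  obtains M where "M \<ge> 0" "\<And>x. x \<in> X \<Longrightarrow> norm (x k) \<le> M * nrm x"
proof -
  have "openin mtopology {x \<in> X. x k \<in> ball 0 1}"
    using openin_continuous_map_preimage[OF assms, of "ball 0 1"] by simp
  then obtain r where r: "r > 0" "mball 0 r \<subseteq> {x \<in> X. x k \<in> ball 0 1}"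
    using zero_in unfolding openin_mtopology by force
  have small: "norm (x k) < 1" if "x \<in> X" "nrm x < r" for x
  proof -
    have "x \<in> mball 0 r"
      using that zero_in nrm_commute[OF zero_in that(1)] unfolding mem_mball by simp
    then show ?thesis
      using r by auto
  qed
  have "norm (x k) \<le> (2 / r) * nrm x" if "x \<in> X" for x
    by (rule bounded_of_small[OF r(1), where g = "\<lambda>x. norm (x k)"])
      (simp_all add: small that norm_mult seq_scale_apply)
  then show ?thesis
    using r by (intro that[of "2 / r"]) auto
qed

end

section \<open>Truncations and the norm of the partial sums\<close>

definition restrict_seq :: "int set \<Rightarrow> (int \<Rightarrow> 'k::field) \<Rightarrow> int \<Rightarrow> 'k" where
  "restrict_seq S x = (\<lambda>k. if k \<in> S then x k else 0)"

lemma restrict_seq_eq_sum: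
  assumes "finite S"
  shows "restrict_seq S x = (\<Sum>k\<in>S. seq_scale (x k) (unit_seq k))"
proof
  fix i
  have "(\<Sum>k\<in>S. x k * (if i = k then 1 else 0)) = (\<Sum>k\<in>S. if i = k then x k else 0)"
    by (intro sum.cong) auto
  then show "restrict_seq S x i = (\<Sum>k\<in>S. seq_scale (x k) (unit_seq k)) i"
    using assms by (simp add: restrict_seq_def sum_seq_apply seq_scale_apply unit_seq_def)
qed

lemma partial_sum_eq: "partial_sum x m n = restrict_seq {- int m..int n} x"
  by (simp add: partial_sum_def restrict_seq_eq_sum)

lemma partial_sum_apply: "partial_sum x m n k = (if - int m \<le> k \<and> k \<le> int n then x k else 0)"
  by (simp add: partial_sum_eq restrict_seq_def)

locale unit_seq_norm = seq_norm X nrm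
  for X :: "(int \<Rightarrow> 'k::{real_normed_field, euclidean_space}) set" and nrm +
  assumes unit_seq_in: "unit_seq n \<in> X"
begin

lemma restrict_seq_in: "finite S \<Longrightarrow> restrict_seq S x \<in> X"
  by (auto simp: restrict_seq_eq_sum intro!: sum_in scale_in unit_seq_in)

lemma partial_sum_in: "partial_sum x m n \<in> X"
  by (simp add: partial_sum_eq restrict_seq_in)

lemma nrm_restrict_seq_le:
  assumes "finite S"
  shows "nrm (restrict_seq S x) \<le> (\<Sum>k\<in>S. norm (x k) * nrm (unit_seq k))"
  unfolding restrict_seq_eq_sum[OF assms] by (rule nrm_sum_scale_le) (rule unit_seq_in)

lemma nrm_unit_seq_pos: "nrm (unit_seq k) > 0"
proof -
  have "unit_seq k \<noteq> (0 :: int \<Rightarrow> 'k)"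
    by (auto simp: unit_seq_def fun_eq_iff intro!: exI[of _ k])
  then show ?thesis
    using nrm_eq_0[OF unit_seq_in, of k] nrm_nonneg[OF unit_seq_in, of k] by linarith
qed

lemma triple_norm_le_iff:
  "triple_norm nrm x \<le> ereal c \<longleftrightarrow> (\<forall>m n. nrm (partial_sum x m n) \<le> c)"
  by (auto simp: triple_norm_def SUP_le_iff)

lemma triple_norm_nonneg: "0 \<le> triple_norm nrm x"
proof -
  have "ereal (nrm (partial_sum x 0 0)) \<le> triple_norm nrm x"
    unfolding triple_norm_def by (rule SUP_upper2[of "(0, 0)"]) auto
  then show ?thesis
    using nrm_nonneg[OF partial_sum_in, of x 0 0] by (metis ereal_less_eq(5) order_trans)
qed

lemma triple_norm_eq: "x \<in> hat_space nrm \<Longrightarrow> triple_norm nrm x = ereal (hat_norm nrm x)"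
  using triple_norm_nonneg[of x]
  by (cases "triple_norm nrm x") (auto simp: hat_space_def hat_norm_def)

lemma nrm_partial_sum_le: "x \<in> hat_space nrm \<Longrightarrow> nrm (partial_sum x m n) \<le> hat_norm nrm x"
  using triple_norm_le_iff[of x "hat_norm nrm x"] triple_norm_eq[of x] by simp

lemma hat_norm_le:
  assumes "\<And>m n. nrm (partial_sum x m n) \<le> c"
  shows "x \<in> hat_space nrm" "hat_norm nrm x \<le> c"
proof -
  have *: "triple_norm nrm x \<le> ereal c"
    using assms by (simp add: triple_norm_le_iff)
  then show "x \<in> hat_space nrm"
    by (auto simp: hat_space_def intro: le_less_trans)
  with * show "hat_norm nrm x \<le> c"
    by (simp add: triple_norm_eq)
qed

lemma hat_norm_less:
  assumes "triple_norm nrm x < ereal c"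
  shows "x \<in> hat_space nrm" "hat_norm nrm x < c"
proof -
  show "x \<in> hat_space nrm"
    using assms by (auto simp: hat_space_def intro: less_trans)
  then show "hat_norm nrm x < c"
    using assms by (simp add: triple_norm_eq)
qed

lemma partial_sum_linear:
  "partial_sum (x + y) m n = partial_sum x m n + partial_sum y m n"
  "partial_sum (x - y) m n = partial_sum x m n - partial_sum y m n"
  "partial_sum (seq_scale c x) m n = seq_scale c (partial_sum x m n)"
  by (auto simp: fun_eq_iff partial_sum_apply seq_scale_apply)

lemma normed_hat: "normed_sequence_space (hat_space nrm) (hat_norm nrm)"
proof -
  have add: "x + y \<in> hat_space nrm \<and> hat_norm nrm (x + y) \<le> hat_norm nrm x + hat_norm nrm y"
    if "x \<in> hat_space nrm" "y \<in> hat_space nrm" for x y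
  proof -
    have "nrm (partial_sum (x + y) m n) \<le> hat_norm nrm x + hat_norm nrm y" for m n
      using nrm_triangle[OF partial_sum_in[of x m n] partial_sum_in[of y m n]]
        nrm_partial_sum_le[OF that(1), of m n] nrm_partial_sum_le[OF that(2), of m n]
      by (simp add: partial_sum_linear)
    then show ?thesis
      using hat_norm_le by blast
  qed
  have scale_le: "seq_scale c x \<in> hat_space nrm \<and> hat_norm nrm (seq_scale c x) \<le> norm c * hat_norm nrm x"
    if "x \<in> hat_space nrm" for c x
  proof -
    have "nrm (partial_sum (seq_scale c x) m n) \<le> norm c * hat_norm nrm x" for m n
      using nrm_partial_sum_le[OF that, of m n]
      by (simp add: partial_sum_linear nrm_scale[OF partial_sum_in] mult_left_mono)
    then show ?thesis
      using hat_norm_le by blast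
  qed
  have nonneg: "0 \<le> hat_norm nrm x" if "x \<in> hat_space nrm" for x
    using nrm_nonneg[OF partial_sum_in, of x 0 0] nrm_partial_sum_le[OF that, of 0 0] by linarith
  have zero: "0 \<in> hat_space nrm \<and> hat_norm nrm 0 \<le> 0"
  proof -
    have "partial_sum 0 m n = (0 :: int \<Rightarrow> 'k)" for m n
      by (auto simp: fun_eq_iff partial_sum_apply)
    then show ?thesis
      using hat_norm_le[of 0 0] nrm_0 by simp
  qed
  have scale: "hat_norm nrm (seq_scale c x) = norm c * hat_norm nrm x"
    if x: "x \<in> hat_space nrm" for c x
  proof (cases "c = 0")
    case True
    then have "seq_scale c x = 0"
      by (auto simp: fun_eq_iff seq_scale_apply)
    then show ?thesis
      using zero nonneg[of 0] True by simp
  next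
    case False
    then have "seq_scale (inverse c) (seq_scale c x) = x"
      by (auto simp: fun_eq_iff seq_scale_apply)
    with scale_le[of "seq_scale c x" "inverse c"] scale_le[OF x, of c]
    have "hat_norm nrm x \<le> inverse (norm c) * hat_norm nrm (seq_scale c x)"
      by (simp add: norm_inverse)
    with scale_le[OF x, of c] False show ?thesis
      by (simp add: field_simps)
  qed
  have definite: "x = 0" if x: "x \<in> hat_space nrm" "hat_norm nrm x = 0" for x
  proof
    fix k
    have "nrm (partial_sum x (nat \<bar>k\<bar>) (nat \<bar>k\<bar>)) = 0"
      using nrm_partial_sum_le[OF x(1)] x(2) nrm_nonneg[OF partial_sum_in] by (metis order_antisym)
    then have "partial_sum x (nat \<bar>k\<bar>) (nat \<bar>k\<bar>) k = 0"
      using nrm_eq_0[OF partial_sum_in] by fastforce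
    then show "x k = 0 k"
      by (auto simp: partial_sum_apply split: if_splits)
  qed
  show ?thesis
    unfolding normed_sequence_space_def seqs.subspace_def
  proof (intro conjI ballI allI)
    show "hat_norm nrm x = 0 \<longleftrightarrow> x = 0" if "x \<in> hat_space nrm" for x
      using definite[OF that] zero nonneg[of 0] by auto
  qed (use add scale_le scale nonneg zero in auto)
qed

sublocale hat: seq_norm "hat_space nrm" "hat_norm nrm"
  by standard (rule normed_hat)

text \<open>
  An interval of indices need not contain 0; then its truncation is a difference of two
  partial sums, which costs the factor 2.
\<close>

lemma nrm_restrict_interval_le:
  assumes x: "x \<in> hat_space nrm"
  shows "nrm (restrict_seq {a..b} x) \<le> 2 * hat_norm nrm x"
proof -
  have pos: "0 \<le> hat_norm nrm x"
    by (rule hat.nrm_nonneg[OF x])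
  consider "b < a" | "0 < a" "a \<le> b" | "b < 0" "a \<le> b" | "a \<le> 0" "0 \<le> b"
    by linarith
  then show ?thesis
  proof cases
    case 1
    then have "restrict_seq {a..b} x = 0"
      by (auto simp: restrict_seq_def)
    with pos show ?thesis
      by (simp add: nrm_0)
  next
    case 2
    then have "restrict_seq {a..b} x = partial_sum x 0 (nat b) - partial_sum x 0 (nat (a - 1))"
      by (auto simp: restrict_seq_def partial_sum_apply fun_eq_iff)
    with nrm_diff_le[OF partial_sum_in partial_sum_in, of x 0 "nat b" x 0 "nat (a - 1)"]
      nrm_partial_sum_le[OF x, of 0 "nat b"] nrm_partial_sum_le[OF x, of 0 "nat (a - 1)"]
    show ?thesis
      by simp
  next
    case 3
    then have "restrict_seq {a..b} x = partial_sum x (nat (- a)) 0 - partial_sum x (nat (- b - 1)) 0"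
      by (auto simp: restrict_seq_def partial_sum_apply fun_eq_iff)
    with nrm_diff_le[OF partial_sum_in partial_sum_in, of x "nat (- a)" 0 x "nat (- b - 1)" 0]
      nrm_partial_sum_le[OF x, of "nat (- a)" 0] nrm_partial_sum_le[OF x, of "nat (- b - 1)" 0]
    show ?thesis
      by simp
  next
    case 4
    then have "restrict_seq {a..b} x = partial_sum x (nat (- a)) (nat b)"
      by (auto simp: restrict_seq_def partial_sum_apply fun_eq_iff)
    with nrm_partial_sum_le[OF x, of "nat (- a)" "nat b"] pos show ?thesis
      by simp
  qed
qed

lemma hat_coordinate_le:
  assumes "x \<in> hat_space nrm"
  shows "norm (x k) * nrm (unit_seq k) \<le> 2 * hat_norm nrm x"
proof -
  have "restrict_seq {k..k} x = seq_scale (x k) (unit_seq k)"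
    by (auto simp: restrict_seq_def unit_seq_def fun_eq_iff seq_scale_apply)
  with nrm_restrict_interval_le[OF assms, of k k] show ?thesis
    by (simp add: nrm_scale[OF unit_seq_in])
qed

lemma finite_support_in_hat:
  assumes "finite S" "\<And>k. k \<notin> S \<Longrightarrow> x k = 0"
  shows "x \<in> hat_space nrm" "hat_norm nrm x \<le> (\<Sum>k\<in>S. norm (x k) * nrm (unit_seq k))"
proof -
  have "nrm (partial_sum x m n) \<le> (\<Sum>k\<in>S. norm (x k) * nrm (unit_seq k))" for m n
  proof -
    have "partial_sum x m n = restrict_seq (S \<inter> {- int m..int n}) x"
      using assms(2) by (auto simp: restrict_seq_def partial_sum_apply fun_eq_iff)
    then have "nrm (partial_sum x m n) \<le> (\<Sum>k\<in>S \<inter> {- int m..int n}. norm (x k) * nrm (unit_seq k))"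
      using nrm_restrict_seq_le[of "S \<inter> {- int m..int n}" x] assms(1) by simp
    also have "\<dots> \<le> (\<Sum>k\<in>S. norm (x k) * nrm (unit_seq k))"
      using assms(1) by (intro sum_mono2) (auto intro!: mult_nonneg_nonneg nrm_nonneg unit_seq_in)
    finally show ?thesis .
  qed
  from hat_norm_le[OF this] show "x \<in> hat_space nrm"
    "hat_norm nrm x \<le> (\<Sum>k\<in>S. norm (x k) * nrm (unit_seq k))" by auto
qed

text \<open>
  The partial sums of a shifted sequence are images of truncations to intervals, so the norm
  of a weighted shift on the larger space is controlled by its norm on the original space
  even though it need not map the larger space into the original one.
\<close>

lemma weighted_shift_bounded_hat:
  assumes T: "operator_on X nrm T" and form: "\<And>x. x \<in> X \<Longrightarrow> T x = (\<lambda>k. a k * x (k + s))"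
  obtains K where "K \<ge> 1"
    "\<And>x. x \<in> hat_space nrm \<Longrightarrow> (\<lambda>k. a k * x (k + s)) \<in> hat_space nrm"
    "\<And>x. x \<in> hat_space nrm \<Longrightarrow> hat_norm nrm (\<lambda>k. a k * x (k + s)) \<le> K * hat_norm nrm x"
proof -
  obtain K where K: "K \<ge> 1" "\<And>x. x \<in> X \<Longrightarrow> nrm (T x) \<le> K * nrm x"
    using operator_bounded[OF T] by blast
  have *: "nrm (partial_sum (\<lambda>k. a k * x (k + s)) m n) \<le> 2 * K * hat_norm nrm x"
    if x: "x \<in> hat_space nrm" for x m n
  proof -
    let ?r = "restrict_seq {s - int m..s + int n} x"
    have "partial_sum (\<lambda>k. a k * x (k + s)) m n = T ?r"
      using form[OF restrict_seq_in, of "{s - int m..s + int n}" x]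
      by (auto simp: partial_sum_apply restrict_seq_def fun_eq_iff)
    then have "nrm (partial_sum (\<lambda>k. a k * x (k + s)) m n) \<le> K * nrm ?r"
      using K(2)[OF restrict_seq_in] by simp
    also have "\<dots> \<le> K * (2 * hat_norm nrm x)"
      using K(1) nrm_restrict_interval_le[OF x] by (intro mult_left_mono) auto
    finally show ?thesis
      by (simp add: algebra_simps)
  qed
  show ?thesis
    using K(1) hat_norm_le[OF *] by (intro that[of "2 * K"]) auto
qed

text \<open>
  A series that converges absolutely in the norm of the partial sums converges coordinatewise,
  and coordinatewise convergence is norm convergence of each finite truncation.
\<close>

lemma hat_norm_suminf_le:
  assumes u: "\<And>i. u i \<in> hat_space nrm" and le: "\<And>i. hat_norm nrm (u i) \<le> b i"
    and b: "summable b"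
  shows "summable (\<lambda>i. u i k)"
    and "(\<lambda>k. \<Sum>i. u i k) \<in> hat_space nrm"
    and "hat_norm nrm (\<lambda>k. \<Sum>i. u i k) \<le> (\<Sum>i. b i)"
proof -
  have summ: "summable (\<lambda>i. u i k)" for k
  proof (rule summable_comparison_test')
    show "summable (\<lambda>i. 2 * b i / nrm (unit_seq k))"
      by (intro summable_mult summable_divide b)
    show "norm (u i k) \<le> 2 * b i / nrm (unit_seq k)" if "i \<ge> 0" for i
      using hat_coordinate_le[OF u[of i], of k] le[of i] nrm_unit_seq_pos[of k]
      by (simp add: field_simps)
  qed
  then show "summable (\<lambda>i. u i k)" .
  let ?z = "\<lambda>k. \<Sum>i. u i k"
  have "nrm (partial_sum ?z m n) \<le> (\<Sum>i. b i)" for m n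
  proof (rule LIMSEQ_le_const)
    let ?S = "{- int m..int n}"
    let ?err = "\<lambda>I. \<Sum>k\<in>?S. norm (?z k - (\<Sum>i<I. u i k)) * nrm (unit_seq k)"
    have "(\<lambda>I. ?z k - (\<Sum>i<I. u i k)) \<longlonglongrightarrow> ?z k - ?z k" for k
      by (intro tendsto_diff tendsto_const summable_LIMSEQ summ)
    then have "?err \<longlonglongrightarrow> (\<Sum>k\<in>?S. norm (?z k - ?z k) * nrm (unit_seq k))"
      by (intro tendsto_sum tendsto_mult tendsto_norm tendsto_const)
    then have err: "?err \<longlonglongrightarrow> 0"
      by simp
    then show "(\<lambda>I. (\<Sum>i. b i) + ?err I) \<longlonglongrightarrow> (\<Sum>i. b i)"
      using tendsto_add[OF tendsto_const[of "\<Sum>i. b i"] err] by simp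
    have "nrm (partial_sum ?z m n) \<le> (\<Sum>i. b i) + ?err I" for I
    proof -
      let ?U = "\<Sum>i<I. seq_scale 1 (u i)"
      have "nrm (partial_sum ?U m n) \<le> hat_norm nrm ?U"
        by (intro nrm_partial_sum_le hat.sum_in hat.scale_in u)
      also have "\<dots> \<le> (\<Sum>i<I. hat_norm nrm (u i))"
        using hat.nrm_sum_scale_le[of "{..<I}" u "\<lambda>_. 1"] u by simp
      also have "\<dots> \<le> (\<Sum>i<I. b i)"
        by (intro sum_mono le)
      also have "\<dots> \<le> (\<Sum>i. b i)"
        using b le hat.nrm_nonneg[OF u] by (intro sum_le_suminf) (auto intro: order_trans)
      finally have U: "nrm (partial_sum ?U m n) \<le> (\<Sum>i. b i)" .
      have "nrm (partial_sum (?z - ?U) m n) \<le> ?err I"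
        using nrm_restrict_seq_le[of ?S "?z - ?U"] by (simp add: partial_sum_eq sum_seq_apply)
      moreover have "partial_sum ?z m n = partial_sum ?U m n + partial_sum (?z - ?U) m n"
        by (simp add: partial_sum_linear)
      ultimately show ?thesis
        using U nrm_triangle[OF partial_sum_in partial_sum_in, of ?U m n "?z - ?U" m n] by simp
    qed
    then show "\<exists>N. \<forall>I\<ge>N. nrm (partial_sum ?z m n) \<le> (\<Sum>i. b i) + ?err I"
      by blast
  qed
  from hat_norm_le[OF this] show "?z \<in> hat_space nrm" "hat_norm nrm ?z \<le> (\<Sum>i. b i)"
    by auto
qed

text \<open>
  A partial sum of \<open>x - partial_sum x N N\<close> consists of a left and a right end piece, and each of
  them is a difference of two partial sums of \<open>x\<close> that contain the interval from \<open>- N\<close>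
  to \<open>N\<close>. So the Cauchy property of the partial sums, which convergence in \<open>X\<close> gives,
  yields smallness of all partial sums of the remainder simultaneously.
\<close>

lemma partial_sums_approximate_hat:
  assumes basis: "unit_seqs_basis X nrm" and x: "x \<in> X" and e: "e > 0"
  obtains N where "x - partial_sum x N N \<in> hat_space nrm"
    "hat_norm nrm (x - partial_sum x N N) < e"
proof -
  have lim: "limitin mtopology (\<lambda>(m, n). partial_sum x m n) x (sequentially \<times>\<^sub>F sequentially)"
    using basis x unfolding unit_seqs_basis_def by blast
  have "\<forall>\<^sub>F p in sequentially \<times>\<^sub>F sequentially.
      (case p of (m, n) \<Rightarrow> partial_sum x m n) \<in> X \<and>
      seq_dist X nrm (case p of (m, n) \<Rightarrow> partial_sum x m n) x < e / 8"
    using conjunct2[OF lim[unfolded limitin_metric], rule_format, of "e / 8"] e by simp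
  then obtain N where N: "\<And>m n. m \<ge> N \<Longrightarrow> n \<ge> N \<Longrightarrow> nrm (partial_sum x m n - x) < e / 8"
    unfolding eventually_prod_sequentially by (auto simp: seq_dist_eq x partial_sum_in)
  let ?c = "partial_sum x N N"
  have near: "nrm (partial_sum x m n - ?c) \<le> e / 4" if "m \<ge> N" "n \<ge> N" for m n
  proof -
    have split: "partial_sum x m n - ?c = (partial_sum x m n - x) - (?c - x)"
      by (auto simp: fun_eq_iff)
    have "nrm (partial_sum x m n - ?c) \<le> nrm (partial_sum x m n - x) + nrm (?c - x)"
      unfolding split by (intro nrm_diff_le diff_in partial_sum_in x)
    then show ?thesis
      using N[OF that] N[of N N] by linarith
  qed
  have "nrm (partial_sum (x - ?c) m n) \<le> e / 2" for m n
  proof -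
    let ?l = "partial_sum x (max m N) N - ?c" and ?r = "partial_sum x N (max n N) - ?c"
    have split: "partial_sum (x - ?c) m n = ?l + ?r"
      by (auto simp: fun_eq_iff partial_sum_apply)
    have "nrm (partial_sum (x - ?c) m n) \<le> nrm ?l + nrm ?r"
      unfolding split by (intro nrm_triangle diff_in partial_sum_in)
    then show ?thesis
      using near[of "max m N" N] near[of N "max n N"] by linarith
  qed
  from hat_norm_le[OF this] e show ?thesis
    by (intro that[of N]) auto
qed

end

section \<open>The powers of a weighted shift and the associated series\<close>

lemma shift_weights_step: "w (k + 1) * shift_weights w (k + 1) = shift_weights w k"
  if nz: "\<And>n. w n \<noteq> (0::'k::field)"
proof (cases "k \<ge> 0")
  case True
  then have "{1..k + 1} = insert (k + 1) {1..k}"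
    by auto
  then show ?thesis
    using True nz by (cases "k = 0") (simp_all add: shift_weights_def)
next
  case False
  then have "{k + 1..0} = insert (k + 1) {k + 1 + 1..0}"
    by auto
  then show ?thesis
    using False unfolding shift_weights_def by simp
qed

lemma shift_weights_nonzero: "(\<And>n. w n \<noteq> (0::'k::field)) \<Longrightarrow> shift_weights w k \<noteq> 0"
  by (simp add: shift_weights_def)

lemma backward_shift_power:
  assumes nz: "\<And>n. w n \<noteq> (0::'k::field)"
  defines "v \<equiv> shift_weights w"
  shows "(backward_shift w ^^ n) x k = v k / v (k + int n) * x (k + int n)"
proof (induction n arbitrary: k)
  case 0
  then show ?case
    using shift_weights_nonzero[OF nz] by (simp add: v_def)
next
  case (Suc n)
  have "(backward_shift w ^^ Suc n) x k = w (k + 1) * (v (k + 1) / v (k + 1 + int n) * x (k + 1 + int n))"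
    unfolding funpow.simps comp_apply backward_shift_def[of w "(backward_shift w ^^ n) x"] Suc ..
  also have "\<dots> = w (k + 1) * v (k + 1) / v (k + int (Suc n)) * x (k + int (Suc n))"
    by (simp add: algebra_simps)
  finally show ?case
    using shift_weights_step[where w = w, OF nz, of k] by (simp add: v_def)
qed

definition translated_series ::
    "(int \<Rightarrow> 'k::field) \<Rightarrow> nat set \<Rightarrow> nat \<Rightarrow> int \<Rightarrow> int \<Rightarrow> 'k" where
  "translated_series v A m j = (\<lambda>k. if \<exists>n\<in>A. k = int n - int m + j then v k else 0)"

lemma translated_series_eq:
  "translated_series v A m j =
     shifted_series v A m j + (if m \<in> A then seq_scale (v j) (unit_seq j) else 0)"
  by (auto simp: fun_eq_iff translated_series_def shifted_series_def seq_scale_def unit_seq_def)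

lemma backward_shift_power_translated_series:
  assumes nz: "\<And>n. v n \<noteq> (0::'k::field)"
  shows "v k / v (k + int m) * translated_series v A 0 j (k + int m) = translated_series v A m j k"
proof -
  have "(\<exists>n\<in>A. k + int m = int n + j) \<longleftrightarrow> (\<exists>n\<in>A. k = int n - int m + j)"
    by (intro bex_cong) auto
  then show ?thesis
    using nz by (simp add: translated_series_def)
qed

section \<open>Changing the tolerances and the range of shifts\<close>

lemma small_series_condition_mono:
  assumes "small_series_condition nrm v \<A> J \<epsilon>" and "\<And>p. J' p \<subseteq> J p"
  shows "small_series_condition nrm v \<A> J' \<epsilon>"
  using assms unfolding small_series_condition_def by (metis subsetD)

text \<open>
  Passing to a subsequence of the sets replaces the tolerances by a subsequence, which can be
  chosen below any prescribed positive sequence. The range of shifts only grows.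
\<close>

lemma small_series_condition_any_tolerance:
  assumes mono: "\<And>p p'. p \<le> p' \<Longrightarrow> J p \<subseteq> J p'"
    and \<epsilon>: "null_positive \<epsilon>" and cond: "small_series_condition nrm v \<A> J \<epsilon>"
    and \<epsilon>': "null_positive \<epsilon>'"
  shows "small_series_condition nrm v \<A> J \<epsilon>'"
proof -
  obtain A where A: "\<forall>p\<ge>1. A p \<in> \<A>" "disjoint_family_on A {1..}"
    "\<And>p q m j. p \<ge> 1 \<Longrightarrow> q \<ge> 1 \<Longrightarrow> m \<in> A q \<Longrightarrow> j \<in> J p \<Longrightarrow>
        triple_norm nrm (shifted_series v (A p) m j) < ereal (min (\<epsilon> p) (\<epsilon> q))"
    using cond unfolding small_series_condition_def by blast
  have "\<exists>N. \<forall>n\<ge>N. p \<ge> 1 \<longrightarrow> \<epsilon> n < \<epsilon>' p" for p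
  proof (cases "p \<ge> 1")
    case True
    then have "\<epsilon>' p > 0"
      using \<epsilon>' by (simp add: null_positive_def)
    then show ?thesis
      using \<epsilon> order_tendstoD(2)[of \<epsilon> 0 sequentially "\<epsilon>' p"]
      by (auto simp: null_positive_def eventually_sequentially)
  qed auto
  then obtain N where N: "\<And>p n. n \<ge> N p \<Longrightarrow> p \<ge> 1 \<Longrightarrow> \<epsilon> n < \<epsilon>' p"
    by metis
  define \<phi> where "\<phi> p = p + (\<Sum>i\<le>p. N i)" for p
  have "strict_mono \<phi>"
    by (rule strict_mono_Suc_iff[THEN iffD2]) (simp add: \<phi>_def)
  then have inj: "inj \<phi>"
    by (rule strict_mono_imp_inj_on)
  have ge: "\<phi> p \<ge> p" for p
    by (simp add: \<phi>_def)
  have small: "\<epsilon> (\<phi> p) < \<epsilon>' p" if "p \<ge> 1" for p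
    using member_le_sum[of p "{..p}" N] by (intro N that) (simp add: \<phi>_def trans_le_add2)
  show ?thesis
    unfolding small_series_condition_def
  proof (intro exI[of _ "\<lambda>p. A (\<phi> p)"] conjI allI impI ballI)
    show "A (\<phi> p) \<in> \<A>" if "p \<ge> 1" for p
      using A(1) ge[of p] that by simp
    show "disjoint_family_on (\<lambda>p. A (\<phi> p)) {1..}"
      unfolding disjoint_family_on_def
    proof (intro ballI impI)
      fix p q :: nat assume "p \<in> {1..}" "q \<in> {1..}" "p \<noteq> q"
      then show "A (\<phi> p) \<inter> A (\<phi> q) = {}"
        using disjoint_family_onD[OF A(2), of "\<phi> p" "\<phi> q"] ge[of p] ge[of q] inj
        by (simp add: inj_eq)
    qed
    fix p q :: nat and m j assume *: "p \<ge> 1" "q \<ge> 1" "m \<in> A (\<phi> q)" "j \<in> J p"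
    then have "triple_norm nrm (shifted_series v (A (\<phi> p)) m j) < ereal (min (\<epsilon> (\<phi> p)) (\<epsilon> (\<phi> q)))"
      using ge[of p] ge[of q] mono[OF ge[of p]] by (intro A(3)) auto
    also have "\<dots> \<le> ereal (min (\<epsilon>' p) (\<epsilon>' q))"
      unfolding ereal_less_eq using small[OF *(1)] small[OF *(2)] by linarith
    finally show "triple_norm nrm (shifted_series v (A (\<phi> p)) m j) < ereal (min (\<epsilon>' p) (\<epsilon>' q))" .
  qed
qed

context unit_seq_norm
begin

text \<open>
  The shift maps the series for \<open>j\<close> to that for \<open>j - 1\<close>, and its inverse, again a weighted
  shift, goes back. Both are bounded for the norm of the partial sums.
\<close>

lemma shifted_series_bound_if_invertible:
  assumes nz: "\<And>n. w n \<noteq> 0" and inv: "invertible_operator_on X nrm (backward_shift w)"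
  obtains K where "K \<ge> 1"
    "\<And>A m j. shifted_series (shift_weights w) A m 0 \<in> hat_space nrm \<Longrightarrow>
       shifted_series (shift_weights w) A m j \<in> hat_space nrm \<and>
       hat_norm nrm (shifted_series (shift_weights w) A m j)
         \<le> K ^ nat \<bar>j\<bar> * hat_norm nrm (shifted_series (shift_weights w) A m 0)"
proof -
  let ?s = "shifted_series (shift_weights w)"
  obtain S where B: "operator_on X nrm (backward_shift w)" and S: "operator_on X nrm S"
    and BS: "\<And>x. x \<in> X \<Longrightarrow> backward_shift w (S x) = x"
    using inv unfolding invertible_operator_on_def by blast
  have S_eq: "S x = (\<lambda>k. inverse (w k) * x (k + - 1))" if "x \<in> X" for x
  proof
    fix k
    have "w k * S x k = x (k + - 1)"
      using fun_cong[OF BS[OF that], of "k - 1"] by (simp add: backward_shift_def)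
    then show "S x k = inverse (w k) * x (k + - 1)"
      using nz[of k] by (simp add: field_simps)
  qed
  obtain K1 where K1: "K1 \<ge> 1"
    "\<And>x. x \<in> hat_space nrm \<Longrightarrow> (\<lambda>k. w (k + 1) * x (k + 1)) \<in> hat_space nrm"
    "\<And>x. x \<in> hat_space nrm \<Longrightarrow> hat_norm nrm (\<lambda>k. w (k + 1) * x (k + 1)) \<le> K1 * hat_norm nrm x"
    using weighted_shift_bounded_hat[OF B, of "\<lambda>k. w (k + 1)" 1] by (auto simp: backward_shift_def)
  obtain K2 where K2: "K2 \<ge> 1"
    "\<And>x. x \<in> hat_space nrm \<Longrightarrow> (\<lambda>k. inverse (w k) * x (k + - 1)) \<in> hat_space nrm"
    "\<And>x. x \<in> hat_space nrm \<Longrightarrow>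
       hat_norm nrm (\<lambda>k. inverse (w k) * x (k + - 1)) \<le> K2 * hat_norm nrm x"
    using weighted_shift_bounded_hat[OF S S_eq] by blast
  define K where "K = max K1 K2"
  have K: "K \<ge> 1"
    using K1(1) by (simp add: K_def)
  have down: "?s A m (j - 1) = (\<lambda>k. w (k + 1) * ?s A m j (k + 1))" for A m j
  proof
    fix k
    have eq: "(\<exists>n\<in>A. n \<noteq> m \<and> k = int n - int m + (j - 1)) \<longleftrightarrow>
        (\<exists>n\<in>A. n \<noteq> m \<and> k + 1 = int n - int m + j)"
      by (intro bex_cong) auto
    then show "?s A m (j - 1) k = w (k + 1) * ?s A m j (k + 1)"
      unfolding shifted_series_def eq by (auto simp: shift_weights_step[where w = w, OF nz])
  qed
  have up: "?s A m (j + 1) = (\<lambda>k. inverse (w k) * ?s A m j (k + - 1))" for A m j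
  proof
    fix k
    have "?s A m j (k + - 1) = w k * ?s A m (j + 1) k"
      using fun_cong[OF down[of A m "j + 1"], of "k - 1"] by simp
    then show "?s A m (j + 1) k = inverse (w k) * ?s A m j (k + - 1)"
      using nz[of k] by simp
  qed
  have step: "?s A m (j - 1) \<in> hat_space nrm \<and> hat_norm nrm (?s A m (j - 1)) \<le> K * hat_norm nrm (?s A m j)"
    "?s A m (j + 1) \<in> hat_space nrm \<and> hat_norm nrm (?s A m (j + 1)) \<le> K * hat_norm nrm (?s A m j)"
    if j: "?s A m j \<in> hat_space nrm" for A m j
  proof -
    have "K1 * hat_norm nrm (?s A m j) \<le> K * hat_norm nrm (?s A m j)"
      "K2 * hat_norm nrm (?s A m j) \<le> K * hat_norm nrm (?s A m j)"
      using hat.nrm_nonneg[OF j] by (auto simp: K_def intro: mult_right_mono)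
    then show "?s A m (j - 1) \<in> hat_space nrm \<and> hat_norm nrm (?s A m (j - 1)) \<le> K * hat_norm nrm (?s A m j)"
      "?s A m (j + 1) \<in> hat_space nrm \<and> hat_norm nrm (?s A m (j + 1)) \<le> K * hat_norm nrm (?s A m j)"
      unfolding down up using K1(2,3)[OF j] K2(2,3)[OF j] by linarith+
  qed
  have iterate: "?s A m (\<sigma> * int i) \<in> hat_space nrm \<and>
      hat_norm nrm (?s A m (\<sigma> * int i)) \<le> K ^ i * hat_norm nrm (?s A m 0)"
    if \<sigma>: "\<sigma> = 1 \<or> \<sigma> = - 1" and 0: "?s A m 0 \<in> hat_space nrm" for \<sigma> i A m
  proof (induction i)
    case 0
    then show ?case
      using that by simp
  next
    case (Suc i)
    have eq: "\<sigma> * int (Suc i) = (if \<sigma> = 1 then \<sigma> * int i + 1 else \<sigma> * int i - 1)"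
      using \<sigma> by (auto simp: algebra_simps)
    have "?s A m (\<sigma> * int (Suc i)) \<in> hat_space nrm \<and>
        hat_norm nrm (?s A m (\<sigma> * int (Suc i))) \<le> K * hat_norm nrm (?s A m (\<sigma> * int i))"
      unfolding eq using step[of A m "\<sigma> * int i"] Suc by (cases "\<sigma> = 1") simp_all
    moreover have "K * hat_norm nrm (?s A m (\<sigma> * int i)) \<le> K * (K ^ i * hat_norm nrm (?s A m 0))"
      using Suc K by (intro mult_left_mono) auto
    ultimately show ?case
      by (auto simp: mult.assoc)
  qed
  show ?thesis
  proof (rule that[OF K])
    fix A m j assume "?s A m 0 \<in> hat_space nrm"
    then show "?s A m j \<in> hat_space nrm \<and>
        hat_norm nrm (?s A m j) \<le> K ^ nat \<bar>j\<bar> * hat_norm nrm (?s A m 0)"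
      using iterate[of 1 A m "nat j"] iterate[of "- 1" A m "nat (- j)"] by (cases "j \<ge> 0") simp_all
  qed
qed

text \<open>
  The factor \<open>K ^ p\<close> lost in passing from \<open>0\<close> to a shift of size at most \<open>p\<close> is
  compensated by tolerances of the form \<open>\<delta> p / K ^ p\<close> with \<open>\<delta>\<close> decreasing: the smaller of two
  tolerances is the one with the larger index, and its power of \<open>K\<close> dominates.
\<close>

lemma small_series_condition_if_invertible:
  assumes nz: "\<And>n. w n \<noteq> 0" and inv: "invertible_operator_on X nrm (backward_shift w)"
    and \<epsilon>: "null_positive \<epsilon>"
    and cond: "small_series_condition nrm (shift_weights w) \<A> (\<lambda>p. {0}) \<epsilon>"
  shows "\<exists>\<epsilon>. null_positive \<epsilon> \<and>
    small_series_condition nrm (shift_weights w) \<A> (\<lambda>p. {- int p..int p}) \<epsilon>"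
proof -
  let ?s = "shifted_series (shift_weights w)"
  obtain K where K: "K \<ge> 1"
    "\<And>A m j. ?s A m 0 \<in> hat_space nrm \<Longrightarrow> ?s A m j \<in> hat_space nrm \<and>
       hat_norm nrm (?s A m j) \<le> K ^ nat \<bar>j\<bar> * hat_norm nrm (?s A m 0)"
    using shifted_series_bound_if_invertible[OF nz inv] by blast
  define \<delta> :: "nat \<Rightarrow> real" where "\<delta> p = 1 / real (Suc p)" for p
  define \<eta> where "\<eta> p = \<delta> p / K ^ p" for p
  have \<delta>: "null_positive \<delta>"
    unfolding null_positive_def \<delta>_def using LIMSEQ_inverse_real_of_nat by (simp add: field_simps)
  have \<delta>_pos: "\<delta> p > 0" and \<delta>_anti: "p \<le> q \<Longrightarrow> \<delta> q \<le> \<delta> p" for p q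
    by (auto simp: \<delta>_def field_simps)
  have Kp: "K ^ p \<ge> 1" for p
    using K(1) by simp
  have \<eta>_pos: "\<eta> p > 0" and \<eta>_le: "\<eta> p \<le> \<delta> p" for p
    using \<delta>_pos[of p] Kp[of p] mult_left_mono[of 1 "K ^ p" "\<delta> p"] by (auto simp: \<eta>_def field_simps)
  have "\<eta> \<longlonglongrightarrow> 0"
    using \<delta> less_imp_le[OF \<eta>_pos] \<eta>_le unfolding null_positive_def
    by (intro tendsto_sandwich[of "\<lambda>_. 0" \<eta> sequentially \<delta> 0]) auto
  then have "null_positive \<eta>"
    using \<eta>_pos by (simp add: null_positive_def)
  with small_series_condition_any_tolerance[OF _ \<epsilon> cond]
  have "small_series_condition nrm (shift_weights w) \<A> (\<lambda>p. {0}) \<eta>"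
    by simp
  then obtain A where A: "\<forall>p\<ge>1. A p \<in> \<A>" "disjoint_family_on A {1..}"
    "\<And>p q m. p \<ge> 1 \<Longrightarrow> q \<ge> 1 \<Longrightarrow> m \<in> A q \<Longrightarrow>
        triple_norm nrm (?s (A p) m 0) < ereal (min (\<eta> p) (\<eta> q))"
    unfolding small_series_condition_def by blast
  have bound: "K ^ p * min (\<eta> p) (\<eta> q) \<le> min (\<delta> p) (\<delta> q)" for p q
  proof -
    let ?r = "max p q"
    have "K ^ p * min (\<eta> p) (\<eta> q) \<le> K ^ ?r * \<eta> ?r"
      using K(1) \<eta>_pos[of p] \<eta>_pos[of q]
      by (intro mult_mono power_increasing) (auto simp: max_def min_def)
    also have "\<dots> = \<delta> ?r"
      using K(1) by (simp add: \<eta>_def)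
    also have "\<dots> \<le> min (\<delta> p) (\<delta> q)"
      using \<delta>_anti by simp
    finally show ?thesis .
  qed
  have "small_series_condition nrm (shift_weights w) \<A> (\<lambda>p. {- int p..int p}) \<delta>"
    unfolding small_series_condition_def
  proof (intro exI[of _ A] conjI A(1,2) allI impI ballI)
    fix p q m j assume *: "p \<ge> 1" "q \<ge> 1" "m \<in> A q" "j \<in> {- int p..int p}"
    note 0 = hat_norm_less[OF A(3)[OF *(1-3)]]
    have "hat_norm nrm (?s (A p) m j) \<le> K ^ nat \<bar>j\<bar> * hat_norm nrm (?s (A p) m 0)"
      using K(2)[OF 0(1)] by blast
    also have "\<dots> \<le> K ^ p * hat_norm nrm (?s (A p) m 0)"
      using K(1) *(4) hat.nrm_nonneg[OF 0(1)] by (intro mult_right_mono power_increasing) auto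
    also have "\<dots> < K ^ p * min (\<eta> p) (\<eta> q)"
      using Kp[of p] 0(2) by (intro mult_strict_left_mono) auto
    also have "\<dots> \<le> min (\<delta> p) (\<delta> q)"
      by (rule bound)
    finally show "triple_norm nrm (?s (A p) m j) < ereal (min (\<delta> p) (\<delta> q))"
      using triple_norm_eq K(2)[OF 0(1)] by simp
  qed
  with \<delta> show ?thesis
    by blast
qed

end

section \<open>Hypercyclicity from the series condition\<close>

text \<open>
  Every finitely supported sequence is approximated, arbitrarily late, by members of a single
  sequence of finitely supported sequences whose supports stay in one finite set. The members
  are decoded from finite lists of indices into a countable dense set of scalars; a second
  component of the code makes each list occur arbitrarily late.
\<close>

lemma dense_finite_coefficients:
  obtains c :: "nat \<Rightarrow> int \<Rightarrow> 'k::euclidean_space"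
  where "\<And>p. finite {j. c p j \<noteq> 0}"
    and "\<And>z. finite {j. z j \<noteq> 0} \<Longrightarrow> \<exists>K. finite K \<and> {j. z j \<noteq> 0} \<subseteq> K \<and>
      (\<forall>e>0. \<forall>N. \<exists>q\<ge>N. {j. c q j \<noteq> 0} \<subseteq> K \<and> (\<forall>k. norm (c q k - z k) < e))"
proof -
  obtain D :: "'k set" where D: "countable D" "\<And>U. open U \<Longrightarrow> U \<noteq> {} \<Longrightarrow> \<exists>d\<in>D. d \<in> U"
    using countable_dense_setE by blast
  define d where "d = from_nat_into D"
  have dense: "\<exists>i. norm (d i - a) < e" if "e > 0" for a e
  proof -
    have "ball a e \<noteq> {}"
      using that by simp
    then obtain b where b: "b \<in> D" "b \<in> ball a e"
      using D(2)[OF open_ball] by blast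
    obtain i where "d i = b"
      using from_nat_into_surj[OF D(1) b(1)] by (auto simp: d_def)
    with b(2) show ?thesis
      by (auto simp: dist_norm norm_minus_commute)
  qed
  define code :: "nat \<Rightarrow> nat list" where "code p = from_nat (fst (prod_decode p))" for p
  define c where "c p j = (if int_encode j < length (code p) then d (code p ! int_encode j) else 0)" for p j
  have fin: "finite {j. int_encode j < L}" for L
  proof -
    have "{j. int_encode j < L} = int_encode -` {..<L}"
      by auto
    then show ?thesis
      by (simp add: finite_vimageI inj_int_encode)
  qed
  show ?thesis
  proof (rule that[of c])
    show "finite {j. c p j \<noteq> 0}" for p
      by (rule finite_subset[OF _ fin[of "length (code p)"]]) (auto simp: c_def split: if_splits)
    fix z :: "int \<Rightarrow> 'k" assume z: "finite {j. z j \<noteq> 0}"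
    then obtain L where L: "\<And>j. z j \<noteq> 0 \<Longrightarrow> int_encode j < L"
      using finite_nat_set_iff_bounded[of "int_encode ` {j. z j \<noteq> 0}"] by auto
    have "\<exists>q\<ge>N. {j. c q j \<noteq> 0} \<subseteq> {j. int_encode j < L} \<and> (\<forall>k. norm (c q k - z k) < e)"
      if e: "e > 0" for e N
    proof -
      obtain f where f: "\<And>i. norm (d (f i) - z (int_decode i)) < e"
        using choice[of "\<lambda>i a. norm (d a - z (int_decode i)) < e"] dense[OF e] by blast
      define q where "q = prod_encode (to_nat (map f [0..<L]), N)"
      have code: "code q = map f [0..<L]"
        by (simp add: q_def code_def)
      have "norm (c q k - z k) < e" for k
        using f[of "int_encode k"] L[of k] e
        by (cases "int_encode k < L"; cases "z k = 0") (auto simp: c_def code)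
      moreover have "q \<ge> N"
        unfolding q_def by (rule le_prod_encode_2)
      moreover have "{j. c q j \<noteq> 0} \<subseteq> {j. int_encode j < L}"
        by (auto simp: c_def code split: if_splits)
      ultimately show ?thesis
        by blast
    qed
    then show "\<exists>K. finite K \<and> {j. z j \<noteq> 0} \<subseteq> K \<and>
      (\<forall>e>0. \<forall>N. \<exists>q\<ge>N. {j. c q j \<noteq> 0} \<subseteq> K \<and> (\<forall>k. norm (c q k - z k) < e))"
      using L fin[of L] by (intro exI[of _ "{j. int_encode j < L}"]) auto
  qed
qed

text \<open>
  Each tolerance is divided by all sizes up to its index. So of the tolerances for \<open>p\<close> and \<open>q\<close>
  the one with the larger index absorbs \<open>S p\<close>, and \<open>p + q \<le> 2 * max p q\<close> turns a power of
  \<open>1/4\<close> into a product of powers of \<open>1/2\<close>.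
\<close>

lemma tolerances_absorbing:
  fixes S :: "nat \<Rightarrow> real"
  assumes S: "\<And>p. S p \<ge> 0"
  obtains \<epsilon> where "null_positive \<epsilon>" "\<And>p. \<epsilon> p > 0"
    "\<And>p q. S p * min (\<epsilon> p) (\<epsilon> q) \<le> (1/2) ^ p * (1/2) ^ q"
proof -
  define R where "R p = 1 + (\<Sum>r\<le>p. S r)" for p
  have R: "R p \<ge> 1" for p
    using S by (simp add: R_def sum_nonneg)
  have SR: "S p \<le> R r" if "p \<le> r" for p r
    using member_le_sum[of p "{..r}" S] S that by (simp add: R_def)
  define \<epsilon> where "\<epsilon> p = (1/4) ^ p / R p" for p
  have pos: "\<epsilon> p > 0" for p
    using R[of p] by (simp add: \<epsilon>_def)
  have "\<epsilon> p \<le> (1/4) ^ p" for p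
    using R[of p] mult_left_mono[of 1 "R p" "(1/4) ^ p"] by (simp add: \<epsilon>_def field_simps)
  then have "\<epsilon> \<longlonglongrightarrow> 0"
    using less_imp_le[OF pos] LIMSEQ_power_zero[of "1/4 :: real"]
    by (intro tendsto_sandwich[of "\<lambda>_. 0" \<epsilon> sequentially "\<lambda>p. (1/4) ^ p" 0]) auto
  then have "null_positive \<epsilon>"
    using pos by (simp add: null_positive_def)
  moreover have "S p * min (\<epsilon> p) (\<epsilon> q) \<le> (1/2) ^ p * (1/2) ^ q" for p q
  proof -
    let ?r = "max p q"
    have "S p * min (\<epsilon> p) (\<epsilon> q) \<le> R ?r * \<epsilon> ?r"
      using S[of p] SR[of p ?r] R[of ?r] pos[of p] pos[of q]
      by (intro mult_mono) (auto simp: max_def min_def)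
    also have "\<dots> = (1/4) ^ ?r"
      using R[of ?r] by (simp add: \<epsilon>_def)
    also have "\<dots> = (1/2) ^ (2 * ?r)"
      by (simp add: power_mult power2_eq_square)
    also have "\<dots> \<le> (1/2) ^ (p + q)"
      by (intro power_decreasing) auto
    finally show ?thesis
      by (simp add: power_add)
  qed
  ultimately show ?thesis
    using that pos by blast
qed

context unit_seq_norm
begin

text \<open>
  The vector is \<open>y = \<Sum>p. \<Sum>j. c p j * (\<Sum>n\<in>A p. v (n + j) e\<^bsub>n + j\<^esub>)\<close>, with \<open>c p\<close> running through
  a dense set of finitely supported coefficients. For \<open>m\<close> in \<open>A q\<close>, the \<open>m\<close>-th power of the
  shift turns the term \<open>n = m\<close> into the target \<open>\<Sum>j. c q j * v j e\<^bsub>j\<^esub>\<close>, and everything else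
  into series that the condition makes small. The tolerances absorb the coefficients.

  That \<open>y\<close> itself has a finite norm is not immediate, because the condition speaks only
  about the shifts by elements \<open>m\<close> of the sets and the shift need not be invertible. But the
  unshifted series for \<open>j\<close> is the series shifted by \<open>m\<^sub>0\<close> for \<open>j + m\<^sub>0\<close>. So one element \<open>m\<^sub>0\<close> of
  \<open>A 1\<close> is fixed, and only those \<open>j\<close> are used in the \<open>p\<close>-th sum for which \<open>j + m\<^sub>0\<close> is still in
  the range from \<open>- p\<close> to \<open>p\<close>. For given \<open>j\<close> these are almost all \<open>p\<close>.
\<close>

lemma hypercyclic_if_small_series:
  assumes basis: "unit_seqs_basis X nrm" and nz: "\<And>n. w n \<noteq> 0" and \<A>: "furstenberg_family \<A>"
    and cond: "\<And>\<epsilon>. null_positive \<epsilon> \<Longrightarrow>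
      small_series_condition nrm (shift_weights w) \<A> (\<lambda>p. {- int p..int p}) \<epsilon>"
  shows "hypercyclic_for \<A> (hat_space nrm) (hat_norm nrm) (backward_shift w) X"
proof -
  define v where "v = shift_weights w"
  have vnz: "v k \<noteq> 0" for k
    using nz by (simp add: v_def shift_weights_nonzero)
  have upward: "B \<in> \<A>" if "A \<in> \<A>" "A \<subseteq> B" for A B
    using \<A> that by (auto simp: furstenberg_family_def)
  obtain c :: "nat \<Rightarrow> int \<Rightarrow> 'k" where c: "\<And>p. finite {j. c p j \<noteq> 0}"
    "\<And>z. finite {j. z j \<noteq> 0} \<Longrightarrow> \<exists>K. finite K \<and> {j. z j \<noteq> 0} \<subseteq> K \<and>
      (\<forall>e>0. \<forall>N. \<exists>q\<ge>N. {j. c q j \<noteq> 0} \<subseteq> K \<and> (\<forall>k. norm (c q k - z k) < e))"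
    using dense_finite_coefficients by blast
  define S where "S p = (\<Sum>j | c p j \<noteq> 0. norm (c p j))" for p
  have "S p \<ge> 0" for p
    by (simp add: S_def sum_nonneg)
  then obtain \<epsilon> where \<epsilon>: "null_positive \<epsilon>" "\<And>p. \<epsilon> p > 0"
    "\<And>p q. S p * min (\<epsilon> p) (\<epsilon> q) \<le> (1/2) ^ p * (1/2) ^ q"
    using tolerances_absorbing by blast
  obtain A where A: "\<And>p. p \<ge> 1 \<Longrightarrow> A p \<in> \<A>" and disj: "disjoint_family_on A {1..}"
    and small: "\<And>p q m j. p \<ge> 1 \<Longrightarrow> q \<ge> 1 \<Longrightarrow> m \<in> A q \<Longrightarrow> j \<in> {- int p..int p} \<Longrightarrow>
        triple_norm nrm (shifted_series v (A p) m j) < ereal (min (\<epsilon> p) (\<epsilon> q))"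
    using cond[OF \<epsilon>(1)] unfolding small_series_condition_def v_def by blast
  show ?thesis
  proof (cases "A 1 = {}")
    case True
    \<comment> \<open>Then the family contains all sets, and any vector will do.\<close>
    then have "B \<in> \<A>" for B
      using upward[of "{}" B] A[of 1] by simp
    then show ?thesis
      unfolding hypercyclic_for_def using hat.zero_in by blast
  next
    case False
    then obtain m0 where m0: "m0 \<in> A 1"
      by blast
    have not_in: "m \<notin> A p" if "p \<ge> 1" "q \<ge> 1" "p \<noteq> q" "m \<in> A q" for p q m
      using disjoint_family_onD[OF disj, of p q] that by auto
    define I where "I p = {j. c p j \<noteq> 0 \<and> p \<ge> 1 \<and> \<bar>j\<bar> + int m0 \<le> int p}" for p
    have I_fin: "finite (I p)" for p
      using c(1) by (rule finite_subset[rotated]) (auto simp: I_def)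
    have sum_I: "(\<Sum>j\<in>I p. norm (c p j)) \<le> S p" for p
      unfolding S_def using c(1) by (intro sum_mono2) (auto simp: I_def)

    \<comment> \<open>The offset \<open>i\<close> will be 0 for the approximation of the targets and \<open>m0\<close> for the norm of \<open>y\<close>.\<close>
    have comb: "hat_norm nrm (\<Sum>j\<in>I p. seq_scale (c p j) (shifted_series v (A p) m (j + i)))
          \<le> (1/2) ^ p * (1/2) ^ q"
        "(\<Sum>j\<in>I p. seq_scale (c p j) (shifted_series v (A p) m (j + i))) \<in> hat_space nrm"
      if q: "q \<ge> 1" "m \<in> A q" and i: "0 \<le> i" "i \<le> int m0" for p q m i
    proof -
      have *: "shifted_series v (A p) m (j + i) \<in> hat_space nrm \<and>
          hat_norm nrm (shifted_series v (A p) m (j + i)) \<le> min (\<epsilon> p) (\<epsilon> q)" if "j \<in> I p" for j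
      proof -
        have "p \<ge> 1" "j + i \<in> {- int p..int p}"
          using that i by (auto simp: I_def)
        from hat_norm_less[OF small[OF this(1) q this(2)]] show ?thesis
          by simp
      qed
      then show "(\<Sum>j\<in>I p. seq_scale (c p j) (shifted_series v (A p) m (j + i))) \<in> hat_space nrm"
        by (intro hat.sum_in hat.scale_in) auto
      have "hat_norm nrm (\<Sum>j\<in>I p. seq_scale (c p j) (shifted_series v (A p) m (j + i)))
          \<le> (\<Sum>j\<in>I p. norm (c p j) * hat_norm nrm (shifted_series v (A p) m (j + i)))"
        using * by (intro hat.nrm_sum_scale_le) auto
      also have "\<dots> \<le> (\<Sum>j\<in>I p. norm (c p j) * min (\<epsilon> p) (\<epsilon> q))"
        using * by (intro sum_mono mult_left_mono) auto
      also have "\<dots> \<le> S p * min (\<epsilon> p) (\<epsilon> q)"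
        unfolding sum_distrib_right[symmetric] using sum_I[of p] \<epsilon>(2)[of p] \<epsilon>(2)[of q]
        by (intro mult_right_mono) auto
      finally show "hat_norm nrm (\<Sum>j\<in>I p. seq_scale (c p j) (shifted_series v (A p) m (j + i)))
          \<le> (1/2) ^ p * (1/2) ^ q"
        using \<epsilon>(3)[of p q] by linarith
    qed

    define u where "u p = (\<Sum>j\<in>I p. seq_scale (c p j) (translated_series v (A p) 0 j))" for p
    have unshift: "translated_series v (A p) 0 j =
        shifted_series v (A p) m0 (j + int m0) +
          (if m0 \<in> A p then seq_scale (v (j + int m0)) (unit_seq (j + int m0)) else 0)" for p j
    proof -
      have "translated_series v (A p) 0 j = translated_series v (A p) m0 (j + int m0)"
        unfolding translated_series_def by (simp add: algebra_simps)
      then show ?thesis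
        by (simp only: translated_series_eq)
    qed
    have unit_hat: "unit_seq k \<in> hat_space nrm" for k
      by (rule finite_support_in_hat(1)[of "{k}"]) (auto simp: unit_seq_def)
    have u_hat: "u p \<in> hat_space nrm" for p
      unfolding u_def
    proof (intro hat.sum_in hat.scale_in)
      fix j assume "j \<in> I p"
      then have "shifted_series v (A p) m0 (j + int m0) \<in> hat_space nrm"
        using m0 by (intro hat_norm_less(1)[OF small[of p 1]]) (auto simp: I_def)
      then show "translated_series v (A p) 0 j \<in> hat_space nrm"
        unfolding unshift by (intro hat.add_in) (auto intro: hat.scale_in unit_hat hat.zero_in)
    qed
    have u_small: "hat_norm nrm (u p) \<le> (1/2) ^ p" if "p \<noteq> 1" for p
    proof (cases "p = 0")
      case True
      then have "u p = 0"
        by (simp add: u_def I_def)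
      then show ?thesis
        by (simp add: hat.nrm_0)
    next
      case False
      then have "m0 \<notin> A p"
        using that m0 by (intro not_in[of p 1]) auto
      then have "u p = (\<Sum>j\<in>I p. seq_scale (c p j) (shifted_series v (A p) m0 (j + int m0)))"
        by (simp add: u_def unshift)
      then have "hat_norm nrm (u p) \<le> (1/2) ^ p * (1/2) ^ 1"
        using comb(1)[of 1 m0 "int m0" p] m0 by simp
      also have "\<dots> \<le> (1/2) ^ p"
        by simp
      finally show ?thesis .
    qed
    \<comment> \<open>Only for \<open>p = 1\<close> may the series contain the term \<open>n = m0\<close> that the condition leaves out.\<close>
    define b where "b p = (if p = 1 then hat_norm nrm (u 1) else (1/2) ^ p)" for p :: nat
    have "eventually (\<lambda>p. b p = (1/2) ^ p) sequentially"
      using eventually_gt_at_top[of 1] by eventually_elim (simp add: b_def)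
    then have b: "summable b"
      by (simp add: summable_cong summable_geometric)
    have u_le: "hat_norm nrm (u p) \<le> b p" for p
      using u_small by (simp add: b_def)
    define y where "y = (\<lambda>k. \<Sum>p. u p k)"
    note u_summable = hat_norm_suminf_le(1)[of u b, OF u_hat u_le b]
    have y_hat: "y \<in> hat_space nrm"
      unfolding y_def by (rule hat_norm_suminf_le(2)[of u b, OF u_hat u_le b])

    define t where "t q = (\<Sum>j\<in>I q. seq_scale (c q j) (seq_scale (v j) (unit_seq j)))" for q
    have t_hat: "t q \<in> hat_space nrm" for q
      unfolding t_def by (intro hat.sum_in hat.scale_in unit_hat)
    have orbit: "(backward_shift w ^^ m) y - t q \<in> hat_space nrm \<and>
        hat_norm nrm ((backward_shift w ^^ m) y - t q) \<le> 2 * (1/2) ^ q"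
      if q: "q \<ge> 1" "m \<in> A q" for q m
    proof -
      define r where "r p = (\<Sum>j\<in>I p. seq_scale (c p j) (shifted_series v (A p) m (j + 0)))" for p
      have r: "r p \<in> hat_space nrm" "hat_norm nrm (r p) \<le> (1/2) ^ p * (1/2) ^ q" for p
        unfolding r_def using comb[OF q, of 0 p] by auto
      have geo: "summable (\<lambda>p. (1/2) ^ p * (1/2) ^ q :: real)"
        by (intro summable_mult2 summable_geometric) simp
      note R = hat_norm_suminf_le[of r, OF r geo]
      have "(backward_shift w ^^ m) y k - t q k = (\<Sum>p. r p k)" for k
      proof -
        have u_term: "v k / v (k + int m) * u p (k + int m) = r p k + (if p = q then t q k else 0)" for p
        proof -
          have "v k / v (k + int m) * u p (k + int m)
              = (\<Sum>j\<in>I p. c p j * (v k / v (k + int m) * translated_series v (A p) 0 j (k + int m)))"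
            by (simp add: u_def sum_seq_apply seq_scale_apply sum_distrib_left mult.left_commute)
          also have "\<dots> = (\<Sum>j\<in>I p. c p j * translated_series v (A p) m j k)"
            by (simp only: backward_shift_power_translated_series[where v = v, OF vnz])
          also have "\<dots> = r p k + (\<Sum>j\<in>I p. c p j * (if m \<in> A p then seq_scale (v j) (unit_seq j) else 0) k)"
            by (simp add: r_def translated_series_eq sum_seq_apply seq_scale_apply distrib_left sum.distrib)
          also have "(\<Sum>j\<in>I p. c p j * (if m \<in> A p then seq_scale (v j) (unit_seq j) else 0) k)
              = (if p = q then t q k else 0)"
          proof (cases "p = q")
            case True
            then show ?thesis
              using q by (simp add: t_def sum_seq_apply seq_scale_apply mult.assoc)
          next
            case False
            then have "I p = {} \<or> m \<notin> A p"
              using not_in[of p q m] q by (auto simp: I_def)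
            with False show ?thesis
              by auto
          qed
          finally show ?thesis .
        qed
        have "(backward_shift w ^^ m) y k = (\<Sum>p. v k / v (k + int m) * u p (k + int m))"
          unfolding backward_shift_power[OF nz] v_def[symmetric] y_def
          by (rule suminf_mult[symmetric]) (rule u_summable)
        also have "\<dots> = (\<Sum>p. r p k + (if p = q then t q k else 0))"
          by (simp only: u_term)
        also have "\<dots> = (\<Sum>p. r p k) + t q k"
          using sums_add[OF summable_sums[OF R(1)] sums_single[of q "\<lambda>_. t q k"]]
          by (simp add: sums_iff)
        finally show ?thesis
          by simp
      qed
      then have "(backward_shift w ^^ m) y - t q = (\<lambda>k. \<Sum>p. r p k)"
        by (simp add: fun_eq_iff)
      moreover have "(\<Sum>p. (1/2) ^ p * (1/2) ^ q :: real) = 2 * (1/2) ^ q"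
        by (subst suminf_mult2[symmetric]) (simp_all add: summable_geometric suminf_geometric)
      ultimately show ?thesis
        using R(2,3) by simp
    qed

    have "{n. (backward_shift w ^^ n) y \<in> U} \<in> \<A>"
      if U: "openin hat.mtopology U" "x \<in> U" "x \<in> X" for U x
    proof -
      have x_hat: "x \<in> hat_space nrm"
        using openin_subset[OF U(1)] U(2) by auto
      obtain \<rho> where \<rho>: "\<rho> > 0" "hat.mball x \<rho> \<subseteq> U"
        using U(1,2) by (auto simp: hat.openin_mtopology)
      obtain N where N: "x - partial_sum x N N \<in> hat_space nrm"
        "hat_norm nrm (x - partial_sum x N N) < \<rho> / 3"
        using partial_sums_approximate_hat[OF basis U(3), of "\<rho> / 3"] \<rho>(1) by auto
      define z where "z = partial_sum x N N"
      have z_fin: "finite {k. z k \<noteq> 0}"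
        by (rule finite_subset[of _ "{- int N..int N}"])
          (auto simp: z_def partial_sum_apply split: if_splits)
      have z_hat: "z \<in> hat_space nrm"
        using z_fin by (rule finite_support_in_hat(1)) simp
      have "finite {k. z k / v k \<noteq> 0}"
        by (rule finite_subset[OF _ z_fin]) auto
      from c(2)[OF this] obtain K where *: "finite K \<and> {k. z k / v k \<noteq> 0} \<subseteq> K \<and>
        (\<forall>e>0. \<forall>N. \<exists>q\<ge>N. {j. c q j \<noteq> 0} \<subseteq> K \<and> (\<forall>k. norm (c q k - z k / v k) < e))" ..
      then have K: "finite K" "{k. z k / v k \<noteq> 0} \<subseteq> K"
        "e > 0 \<Longrightarrow> \<exists>q\<ge>N. {j. c q j \<noteq> 0} \<subseteq> K \<and> (\<forall>k. norm (c q k - z k / v k) < e)" for e N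
        by simp_all
      define C where "C = (\<Sum>k\<in>K. norm (v k) * nrm (unit_seq k))"
      have C: "C \<ge> 0"
        unfolding C_def by (intro sum_nonneg mult_nonneg_nonneg nrm_nonneg unit_seq_in) auto
      define e where "e = \<rho> / (3 * (C + 1))"
      have e: "e > 0" "e * C < \<rho> / 3"
        using \<rho>(1) C by (auto simp: e_def field_simps add_pos_nonneg)
      have "(\<lambda>n. 2 * (1/2) ^ n :: real) \<longlonglongrightarrow> 2 * 0"
        by (intro tendsto_mult tendsto_const LIMSEQ_power_zero) simp
      then have "\<forall>\<^sub>F n in sequentially. 2 * (1/2) ^ n < \<rho> / 3"
        using \<rho>(1) by (intro order_tendstoD(2)[where y = "2 * 0"]) auto
      then obtain M where M: "\<And>n. n \<ge> M \<Longrightarrow> 2 * (1/2) ^ n < \<rho> / 3"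
        by (auto simp: eventually_sequentially)
      \<comment> \<open>From \<open>L\<close> on the range of \<open>j\<close> comprises the whole support of the coefficients.\<close>
      define L where "L = max 1 (max M (m0 + (\<Sum>k\<in>K. nat \<bar>k\<bar>)))"
      obtain q where q: "q \<ge> L" "{j. c q j \<noteq> 0} \<subseteq> K" "\<And>k. norm (c q k - z k / v k) < e"
        using K(3)[OF e(1), of L] by blast
      have q1: "q \<ge> 1" and qM: "q \<ge> M" and qK: "m0 + (\<Sum>k\<in>K. nat \<bar>k\<bar>) \<le> q"
        using q(1) by (auto simp: L_def)
      have Iq: "I q = {j. c q j \<noteq> 0}"
      proof -
        have "\<bar>j\<bar> + int m0 \<le> int q" if "j \<in> K" for j
          using member_le_sum[OF that, of "\<lambda>k. nat \<bar>k\<bar>"] K(1) qK by simp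
        then show ?thesis
          using q1 q(2) by (auto simp: I_def)
      qed
      have t_apply: "t q k = c q k * v k" for k
      proof -
        have "t q k = (\<Sum>j\<in>I q. if k = j then c q j * v j else 0)"
          unfolding t_def sum_seq_apply by (intro sum.cong) (auto simp: seq_scale_apply unit_seq_def)
        also have "\<dots> = c q k * v k"
          using I_fin[of q] by (simp add: Iq)
        finally show ?thesis .
      qed
      have diff: "(z - t q) k = (z k / v k - c q k) * v k" for k
        using vnz[of k] by (simp add: t_apply field_simps)
      have "hat_norm nrm (z - t q) \<le> (\<Sum>k\<in>K. norm ((z - t q) k) * nrm (unit_seq k))"
      proof (rule finite_support_in_hat(2)[OF K(1)])
        fix k assume "k \<notin> K"
        then have "z k / v k = 0" "c q k = 0"
          using K(2) q(2) by auto
        then show "(z - t q) k = 0"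
          unfolding diff by auto
      qed
      also have "\<dots> \<le> (\<Sum>k\<in>K. e * (norm (v k) * nrm (unit_seq k)))"
      proof (intro sum_mono)
        fix k
        have "norm ((z - t q) k) \<le> e * norm (v k)"
          using q(3)[of k] unfolding diff norm_mult norm_minus_commute[of "z k / v k"]
          by (intro mult_right_mono) auto
        then show "norm ((z - t q) k) * nrm (unit_seq k) \<le> e * (norm (v k) * nrm (unit_seq k))"
          using nrm_nonneg[OF unit_seq_in, of k] by (simp only: mult.assoc[symmetric] mult_right_mono)
      qed
      also have "\<dots> < \<rho> / 3"
        using e(2) by (simp add: C_def sum_distrib_left)
      finally have zt: "hat_norm nrm (z - t q) < \<rho> / 3" .
      have "A q \<subseteq> {n. (backward_shift w ^^ n) y \<in> U}"
      proof
        fix m assume m: "m \<in> A q"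
        let ?o = "(backward_shift w ^^ m) y"
        note o = orbit[OF q1 m]
        have o_hat: "?o \<in> hat_space nrm"
          using hat.add_in[OF conjunct1[OF o] t_hat[of q]] by simp
        have "x - ?o = (x - z) + ((z - t q) - (?o - t q))"
          by (auto simp: fun_eq_iff)
        then have "hat_norm nrm (x - ?o) = hat_norm nrm ((x - z) + ((z - t q) - (?o - t q)))"
          by (rule arg_cong)
        also have "\<dots> \<le> hat_norm nrm (x - z) + hat_norm nrm ((z - t q) - (?o - t q))"
          by (intro hat.nrm_triangle hat.diff_in x_hat z_hat t_hat o_hat)
        also have "hat_norm nrm ((z - t q) - (?o - t q)) \<le> hat_norm nrm (z - t q) + hat_norm nrm (?o - t q)"
          by (intro hat.nrm_diff_le hat.diff_in z_hat t_hat o_hat)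
        finally have "hat_norm nrm (x - ?o) < \<rho>"
          using zt N(2) o M[OF qM] unfolding z_def by linarith
        then have "?o \<in> hat.mball x \<rho>"
          unfolding hat.mem_mball using x_hat o_hat by blast
        then show "m \<in> {n. (backward_shift w ^^ n) y \<in> U}"
          using \<rho>(2) by auto
      qed
      then show ?thesis
        using upward[OF A[OF q1]] by blast
    qed
    then show ?thesis
      unfolding hypercyclic_for_def using y_hat by blast
  qed
qed

end

section \<open>Unconditional bases and bounded multipliers\<close>

text \<open>
  An increasing sequence of finite sets that exhausts an infinite type can be listed one set
  after the other.
\<close>

lemma bij_enumerating_chain:
  fixes H :: "nat \<Rightarrow> 'a set"
  assumes fin: "\<And>i. finite (H i)" and chain: "\<And>i. H i \<subseteq> H (Suc i)"
    and cover: "(\<Union>i. H i) = UNIV" and inf: "infinite (UNIV :: 'a set)"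
  obtains \<pi> :: "nat \<Rightarrow> 'a" where "bij \<pi>" "\<And>i. \<pi> ` {..<card (H i)} = H i"
proof -
  obtain l0 where l0: "set l0 = H 0" "distinct l0"
    using finite_distinct_list[OF fin] by blast
  have "\<exists>xs. set xs = H (Suc i) - H i \<and> distinct xs" for i
    using finite_distinct_list[OF finite_Diff[OF fin]] .
  then obtain l where l: "\<And>i. set (l i) = H (Suc i) - H i" "\<And>i. distinct (l i)"
    by metis
  define L where "L = rec_nat l0 (\<lambda>i xs. xs @ l i)"
  have L_simps: "L 0 = l0" "L (Suc i) = L i @ l i" for i
    by (simp_all add: L_def)
  have L: "set (L i) = H i \<and> distinct (L i)" for i
    using chain by (induction i) (auto simp: L_simps l0 l)
  have len: "length (L i) = card (H i)" for i
    using L[of i] distinct_card by metis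
  have prefix: "\<exists>ys. L (i + d) = L i @ ys" for i d
    by (induction d) (auto simp: L_simps)
  have nth_eq: "L j ! n = L i ! n" if "i \<le> j" "n < length (L i)" for i j n
    using prefix[of i "j - i"] that by (auto simp: nth_append)
  have len_mono: "length (L i) \<le> length (L j)" if "i \<le> j" for i j
    using prefix[of i "j - i"] that by auto
  have H_mono: "H i \<subseteq> H j" if "i \<le> j" for i j
    using lift_Suc_mono_le[of H, OF chain that] .
  have "\<exists>i. n < length (L i)" for n
  proof -
    obtain F :: "'a set" where F: "finite F" "card F = Suc n"
      using infinite_arbitrarily_large[OF inf] by blast
    have "\<exists>i. F \<subseteq> H i"
      using F(1)
    proof induction
      case (insert a F)
      then obtain i i' where "F \<subseteq> H i" "a \<in> H i'"
        using cover by blast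
      then have "insert a F \<subseteq> H (max i i')"
        using H_mono[of i "max i i'"] H_mono[of i' "max i i'"] by auto
      then show ?case
        by blast
    qed simp
    then show ?thesis
      using card_mono[OF fin] F(2) len by (metis Suc_le_eq)
  qed
  then obtain I where I: "\<And>n. n < length (L (I n))"
    by metis
  define \<pi> where "\<pi> n = L (I n) ! n" for n
  have \<pi>: "\<pi> n = L i ! n" if "n < length (L i)" for n i
    using nth_eq[of i "I n" n] nth_eq[of "I n" i n] I[of n] that by (cases "i \<le> I n") (auto simp: \<pi>_def)
  have image: "\<pi> ` {..<card (H i)} = H i" for i
  proof -
    have "\<pi> ` {..<card (H i)} = (!) (L i) ` {..<length (L i)}"
      by (intro image_cong) (auto simp: len \<pi>)
    also have "\<dots> = H i"
      using L[of i] by (auto simp: set_conv_nth)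
    finally show ?thesis .
  qed
  have "inj \<pi>"
  proof (rule injI)
    fix a b assume eq: "\<pi> a = \<pi> b"
    let ?i = "max (I a) (I b)"
    have "a < length (L ?i)" "b < length (L ?i)"
      using I[of a] I[of b] len_mono[of "I a" ?i] len_mono[of "I b" ?i] by auto
    then show "a = b"
      using eq L[of ?i] by (simp add: \<pi> nth_eq_iff_index_eq)
  qed
  moreover have "surj \<pi>"
    unfolding surj_def
  proof
    fix k
    obtain i where "k \<in> H i"
      using cover by blast
    then have "k \<in> \<pi> ` {..<card (H i)}"
      by (simp only: image)
    then show "\<exists>n. k = \<pi> n"
      by blast
  qed
  ultimately show ?thesis
    using that image by (simp add: bij_def)
qed

context seq_norm
begin

text \<open>
  Split off the smallest coefficient: it multiplies the whole sum, and the other coefficients,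
  diminished by it, multiply a sum with fewer terms.
\<close>

lemma nrm_nonneg_multiplier_le:
  assumes "finite F" and f: "\<And>k. k \<in> F \<Longrightarrow> f k \<in> X"
    and C: "\<And>G. G \<subseteq> F \<Longrightarrow> nrm (\<Sum>k\<in>G. f k) \<le> C"
    and a: "\<And>k. k \<in> F \<Longrightarrow> 0 \<le> a k" "\<And>k. k \<in> F \<Longrightarrow> a k \<le> M" and M: "0 \<le> M"
  shows "nrm (\<Sum>k\<in>F. seq_scale (of_real (a k)) (f k)) \<le> M * C"
  using assms
proof (induction F arbitrary: a M rule: finite_psubset_induct)
  case (psubset F)
  show ?case
  proof (cases "F = {}")
    case True
    have "C \<ge> 0"
      using psubset.prems(2)[OF empty_subsetI] unfolding sum.empty nrm_0 .
    then show ?thesis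
      unfolding True sum.empty nrm_0 using psubset.prems(5) by simp
  next
    case False
    then have "Min (a ` F) \<in> a ` F"
      using psubset.hyps(1) by (intro Min_in) auto
    then obtain k0 where "k0 \<in> F" "a k0 = Min (a ` F)"
      by force
    then have k0: "k0 \<in> F" "\<And>k. k \<in> F \<Longrightarrow> a k0 \<le> a k"
      using psubset.hyps(1) by auto
    let ?F = "F - {k0}"
    have F: "F = insert k0 ?F"
      using k0(1) by auto
    let ?rest = "\<Sum>k\<in>?F. seq_scale (of_real (a k - a k0)) (f k)"
    have in_X: "?rest \<in> X" "(\<Sum>k\<in>F. f k) \<in> X"
      using psubset.prems(1) by (auto intro!: sum_in scale_in)
    have eq: "(\<Sum>k\<in>F. seq_scale (of_real (a k)) (f k)) = seq_scale (of_real (a k0)) (\<Sum>k\<in>F. f k) + ?rest"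
    proof
      fix i
      have "(\<Sum>k\<in>F. of_real (a k) * f k i)
          = (\<Sum>k\<in>F. of_real (a k0) * f k i) + (\<Sum>k\<in>F. of_real (a k - a k0) * f k i)"
        by (simp add: sum.distrib[symmetric] algebra_simps)
      also have "(\<Sum>k\<in>F. of_real (a k - a k0) * f k i) = (\<Sum>k\<in>?F. of_real (a k - a k0) * f k i)"
        using psubset.hyps(1) by (intro sum.mono_neutral_right) auto
      finally show "(\<Sum>k\<in>F. seq_scale (of_real (a k)) (f k)) i
          = (seq_scale (of_real (a k0)) (\<Sum>k\<in>F. f k) + ?rest) i"
        by (simp only: sum_seq_apply seq_scale_apply plus_fun_apply sum_distrib_left)
    qed
    have "nrm ?rest \<le> (M - a k0) * C"
    proof (rule psubset.IH)
      show "?F \<subset> F"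
        using k0(1) by blast
      show "nrm (\<Sum>k\<in>G. f k) \<le> C" if "G \<subseteq> ?F" for G
        using that by (intro psubset.prems(2)) blast
    qed (use k0 psubset.prems in auto)
    moreover have "nrm (seq_scale (of_real (a k0)) (\<Sum>k\<in>F. f k)) \<le> a k0 * C"
      using psubset.prems(2)[of F] psubset.prems(3)[OF k0(1)]
      by (simp add: nrm_scale[OF in_X(2)] mult_left_mono)
    moreover have "a k0 * C + (M - a k0) * C = M * C"
      by (simp add: algebra_simps)
    ultimately show ?thesis
      unfolding eq using nrm_triangle[OF scale_in[OF in_X(2)] in_X(1), of "of_real (a k0)"]
      by linarith
  qed
qed

text \<open>
  A bounded scalar multiplier is a combination of multipliers with values in an interval from
  0 on: expand the values in the finite basis of the scalar field over the reals and split each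
  coordinate into its positive and negative part.
\<close>

lemma nrm_multiplier_le:
  fixes M C :: real
  assumes F: "finite F" and f: "\<And>k. k \<in> F \<Longrightarrow> f k \<in> X"
    and C: "\<And>G. G \<subseteq> F \<Longrightarrow> nrm (\<Sum>k\<in>G. f k) \<le> C"
    and a: "\<And>k. k \<in> F \<Longrightarrow> norm (a k) \<le> M" and M: "0 \<le> M"
  shows "nrm (\<Sum>k\<in>F. seq_scale (a k) (f k)) \<le> 2 * DIM('k) * (M * C)"
proof -
  let ?part = "\<lambda>s b. \<Sum>k\<in>F. seq_scale (of_real (max (s * (a k \<bullet> b)) 0)) (f k)"
  have part_in: "?part s b \<in> X" for s b
    by (intro sum_in scale_in f)
  have part_le: "nrm (?part s b) \<le> M * C" if "b \<in> Basis" "\<bar>s\<bar> = 1" for s b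
  proof (rule nrm_nonneg_multiplier_le[OF F f C _ _ M])
    fix k assume "k \<in> F"
    have "s * (a k \<bullet> b) \<le> \<bar>a k \<bullet> b\<bar>"
      using abs_ge_self[of "s * (a k \<bullet> b)"] that(2) by (simp add: abs_mult)
    also have "\<dots> \<le> M"
      using Basis_le_norm[OF that(1), of "a k"] a[OF \<open>k \<in> F\<close>] by simp
    finally show "max (s * (a k \<bullet> b)) 0 \<le> M"
      using M by simp
  qed auto
  let ?comp = "\<lambda>b. ?part 1 b - ?part (- 1) b"
  have comp_in: "?comp b \<in> X" for b
    by (intro diff_in part_in)
  have comp_le: "nrm (?comp b) \<le> 2 * (M * C)" if "b \<in> Basis" for b
    using nrm_diff_le[OF part_in part_in, of 1 b "- 1" b] part_le[OF that, of 1] part_le[OF that, of "- 1"]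
    by simp
  have "(\<Sum>k\<in>F. seq_scale (a k) (f k)) = (\<Sum>b\<in>Basis. seq_scale b (?comp b))"
  proof
    fix i
    have comp: "?comp b i = (\<Sum>k\<in>F. of_real (a k \<bullet> b) * f k i)" for b
      unfolding seq_diff_apply sum_seq_apply seq_scale_apply sum_subtractf[symmetric]
        left_diff_distrib[symmetric] of_real_diff[symmetric]
      by (intro sum.cong) (auto simp: max_def)
    have "(\<Sum>b\<in>Basis. b * ?comp b i) = (\<Sum>b\<in>Basis. \<Sum>k\<in>F. b * (of_real (a k \<bullet> b) * f k i))"
      by (simp only: comp sum_distrib_left)
    also have "\<dots> = (\<Sum>k\<in>F. \<Sum>b\<in>Basis. b * (of_real (a k \<bullet> b) * f k i))"
      by (rule sum.swap)
    also have "\<dots> = (\<Sum>k\<in>F. (\<Sum>b\<in>Basis. (a k \<bullet> b) *\<^sub>R b) * f k i)"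
      unfolding sum_distrib_right by (intro sum.cong refl) (simp add: scaleR_conv_of_real mult_ac)
    finally show "(\<Sum>k\<in>F. seq_scale (a k) (f k)) i = (\<Sum>b\<in>Basis. seq_scale b (?comp b)) i"
      by (simp only: euclidean_representation sum_seq_apply seq_scale_apply)
  qed
  then have "nrm (\<Sum>k\<in>F. seq_scale (a k) (f k)) \<le> (\<Sum>b\<in>(Basis::'k set). norm b * nrm (?comp b))"
    using nrm_sum_scale_le[of Basis ?comp "\<lambda>b. b", OF comp_in] by simp
  also have "\<dots> \<le> (\<Sum>b\<in>(Basis::'k set). 2 * (M * C))"
    using comp_le by (intro sum_mono) (simp add: norm_Basis)
  finally show ?thesis
    by simp
qed

end

context unit_seq_norm
begin

text \<open>
  If the subset sums were unbounded, then outside every finite set there would be a finite set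
  whose sum has norm greater than 1; in an enumeration of the integers that contains infinitely
  many such sets as blocks the series would violate the Cauchy criterion.
\<close>

lemma subset_sums_bounded:
  assumes uncond: "unit_seqs_unconditional_basis X nrm" and x: "x \<in> X"
  shows "\<exists>C. \<forall>F. finite F \<longrightarrow> nrm (restrict_seq F x) \<le> C"
proof (rule ccontr)
  assume "\<not> ?thesis"
  then have unbounded: "\<exists>F. finite F \<and> nrm (restrict_seq F x) > C" for C
    by (metis not_le)
  have "\<exists>G. finite G \<and> G \<inter> H = {} \<and> nrm (restrict_seq G x) > 1" if H: "finite H" for H
  proof -
    let ?C = "\<Sum>k\<in>H. norm (x k) * nrm (unit_seq k)"
    obtain F where F: "finite F" "nrm (restrict_seq F x) > ?C + 1"
      using unbounded by blast
    have eq: "restrict_seq F x = restrict_seq (F \<inter> H) x + restrict_seq (F - H) x"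
      by (auto simp: restrict_seq_def fun_eq_iff)
    have "nrm (restrict_seq (F \<inter> H) x) \<le> (\<Sum>k\<in>F \<inter> H. norm (x k) * nrm (unit_seq k))"
      using F(1) by (intro nrm_restrict_seq_le) simp
    also have "\<dots> \<le> ?C"
      using H by (intro sum_mono2) (auto intro!: mult_nonneg_nonneg nrm_nonneg unit_seq_in)
    finally have "nrm (restrict_seq (F - H) x) > 1"
      using F nrm_triangle[OF restrict_seq_in restrict_seq_in, of "F \<inter> H" "F - H" x x]
      unfolding eq by simp
    then show ?thesis
      using F(1) by (intro exI[of _ "F - H"]) auto
  qed
  then obtain G where G: "\<And>H. finite H \<Longrightarrow> finite (G H)" "\<And>H. finite H \<Longrightarrow> G H \<inter> H = {}"
    "\<And>H. finite H \<Longrightarrow> nrm (restrict_seq (G H) x) > 1"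
    by metis
  \<comment> \<open>Every other step adds a block with a large sum, the steps in between exhaust the integers.\<close>
  define H where "H = rec_nat {} (\<lambda>i S. if even i then S \<union> G S else insert (int_decode (i div 2)) S)"
  have H_even: "H (Suc (2 * i)) = H (2 * i) \<union> G (H (2 * i))"
    and H_odd: "H (Suc (Suc (2 * i))) = insert (int_decode i) (H (Suc (2 * i)))" for i
    by (simp_all add: H_def)
  have H_fin: "finite (H i)" for i
    by (induction i) (auto simp: H_def G(1))
  have H_chain: "H i \<subseteq> H (Suc i)" for i
    by (auto simp: H_def)
  have "(\<Union>i. H i) = UNIV"
  proof -
    have "k \<in> H (Suc (Suc (2 * int_encode k)))" for k
      by (simp add: H_odd)
    then show ?thesis
      by blast
  qed
  then obtain \<pi> where \<pi>: "bij \<pi>" "\<And>i. \<pi> ` {..<card (H i)} = H i"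
    using bij_enumerating_chain[of H, OF H_fin H_chain _ infinite_UNIV_int] by blast
  let ?S = "\<lambda>N. \<Sum>i<N. seq_scale (x (\<pi> i)) (unit_seq (\<pi> i))"
  have S_H: "?S (card (H i)) = restrict_seq (H i) x" for i
  proof -
    have "restrict_seq (H i) x = (\<Sum>k\<in>\<pi> ` {..<card (H i)}. seq_scale (x k) (unit_seq k))"
      by (simp add: \<pi>(2) restrict_seq_eq_sum[OF H_fin])
    also have "\<dots> = ?S (card (H i))"
      by (rule sum.reindex_cong[OF inj_on_subset[OF bij_is_inj[OF \<pi>(1)]]]) auto
    finally show ?thesis ..
  qed
  have nonempty: "G (H i) \<noteq> {}" for i
  proof
    assume "G (H i) = {}"
    moreover have "restrict_seq {} x = 0"
      by (auto simp: restrict_seq_def)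
    ultimately show False
      using G(3)[OF H_fin[of i]] nrm_0 by simp
  qed
  have card_ge: "i \<le> card (H (2 * i))" for i
  proof (induction i)
    case (Suc i)
    have "H (2 * i) \<subset> H (Suc (2 * i))"
      using nonempty[of "2 * i"] G(2)[OF H_fin[of "2 * i"]] unfolding H_even by blast
    then have "card (H (2 * i)) < card (H (Suc (2 * i)))"
      by (rule psubset_card_mono[OF H_fin])
    also have "\<dots> \<le> card (H (2 * Suc i))"
      using card_mono[OF H_fin H_chain, of "Suc (2 * i)"] by simp
    finally show ?case
      using Suc by simp
  qed simp
  obtain l where "limitin mtopology ?S l sequentially"
    using uncond x \<pi>(1) unfolding unit_seqs_unconditional_basis_def by blast
  note lim = this[unfolded limit_metric_sequentially]
  have l: "l \<in> X"
    using lim by blast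
  have "\<exists>N. \<forall>n\<ge>N. ?S n \<in> X \<and> seq_dist X nrm (?S n) l < 1/2"
    using conjunct2[OF lim, rule_format, of "1/2"] by simp
  then obtain N where N: "\<And>n. n \<ge> N \<Longrightarrow> ?S n \<in> X \<and> seq_dist X nrm (?S n) l < 1/2"
    by blast
  have near: "nrm (restrict_seq (H i) x - l) < 1/2" if "i = 2 * N \<or> i = Suc (2 * N)" for i
  proof -
    have "N \<le> card (H i)"
      using that card_ge[of N] card_mono[OF H_fin H_chain, of "2 * N"] by auto
    from N[OF this] show ?thesis
      unfolding S_H by (simp only: seq_dist_eq[OF restrict_seq_in[OF H_fin] l])
  qed
  have eq: "restrict_seq (G (H (2 * N))) x
      = (restrict_seq (H (Suc (2 * N))) x - l) - (restrict_seq (H (2 * N)) x - l)"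
    using G(2)[OF H_fin[of "2 * N"]] unfolding H_even by (auto simp: restrict_seq_def fun_eq_iff)
  have "nrm (restrict_seq (G (H (2 * N))) x)
      \<le> nrm (restrict_seq (H (Suc (2 * N))) x - l) + nrm (restrict_seq (H (2 * N)) x - l)"
    unfolding eq by (intro nrm_diff_le diff_in restrict_seq_in H_fin l)
  also have "\<dots> < 1"
    using near[of "2 * N"] near[of "Suc (2 * N)"] by simp
  finally show False
    using G(3)[OF H_fin[of "2 * N"]] by simp
qed

text \<open>
  The uniform boundedness principle for the truncations to finite sets: by Baire's theorem the
  pointwise bounds are uniform on some ball, and a translation and scaling carries the bound from
  there to the unit ball.
\<close>

lemma unconditional_constant:
  assumes banach: "banach_sequence_space X nrm" and uncond: "unit_seqs_unconditional_basis X nrm"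
  obtains C where "C \<ge> 0" "\<And>x F. x \<in> X \<Longrightarrow> finite F \<Longrightarrow> nrm (restrict_seq F x) \<le> C * nrm x"
proof -
  have complete: mcomplete and coord: "\<And>k. continuous_map mtopology euclidean (\<lambda>x. x k)"
    using banach by (auto simp: banach_sequence_space_def)
  have "\<exists>M\<ge>0. \<forall>x\<in>X. norm (x k) \<le> M * nrm x" for k
    by (rule coordinate_bounded[OF coord[of k]]) blast
  then obtain M where M: "\<And>k. M k \<ge> 0" "\<And>k x. x \<in> X \<Longrightarrow> norm (x k) \<le> M k * nrm x"
    by metis
  define E where "E n = {x \<in> X. \<forall>F. finite F \<longrightarrow> nrm (restrict_seq F x) \<le> real n}" for n :: nat
  have closed: "closedin mtopology (E n)" for n
  proof -
    have "openin mtopology (X - E n)"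
      unfolding openin_mtopology
    proof (intro conjI allI impI)
      fix x assume "x \<in> X - E n"
      then have x: "x \<in> X" and "\<not> (\<forall>F. finite F \<longrightarrow> nrm (restrict_seq F x) \<le> real n)"
        by (simp_all add: E_def)
      then obtain F where F: "finite F" "nrm (restrict_seq F x) > real n"
        by (metis not_le)
      define K where "K = (\<Sum>k\<in>F. M k * nrm (unit_seq k))"
      have K: "K \<ge> 0"
        unfolding K_def using M(1) by (intro sum_nonneg mult_nonneg_nonneg nrm_nonneg unit_seq_in)
      have bound: "nrm (restrict_seq F y) \<le> K * nrm y" if "y \<in> X" for y
      proof -
        have "nrm (restrict_seq F y) \<le> (\<Sum>k\<in>F. norm (y k) * nrm (unit_seq k))"
          by (rule nrm_restrict_seq_le[OF F(1)])
        also have "\<dots> \<le> (\<Sum>k\<in>F. M k * nrm y * nrm (unit_seq k))"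
          using M(2)[OF that] nrm_nonneg[OF unit_seq_in] by (intro sum_mono mult_right_mono)
        also have "\<dots> = K * nrm y"
          unfolding K_def sum_distrib_right by (intro sum.cong refl) (simp only: mult_ac)
        finally show ?thesis .
      qed
      define r where "r = (nrm (restrict_seq F x) - real n) / (K + 1)"
      have r: "r > 0" "K * r < nrm (restrict_seq F x) - real n"
        using F(2) K by (auto simp: r_def field_simps)
      have "mball x r \<subseteq> X - E n"
      proof
        fix y assume "y \<in> mball x r"
        then have y: "y \<in> X" "nrm (x - y) < r"
          unfolding mem_mball by auto
        have eq: "restrict_seq F x = restrict_seq F y + restrict_seq F (x - y)"
          by (auto simp: restrict_seq_def fun_eq_iff)
        have "nrm (restrict_seq F x) \<le> nrm (restrict_seq F y) + nrm (restrict_seq F (x - y))"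
          unfolding eq using F(1) by (intro nrm_triangle restrict_seq_in)
        moreover have "nrm (restrict_seq F (x - y)) \<le> K * r"
          using bound[OF diff_in[OF x y(1)]] mult_left_mono[OF less_imp_le[OF y(2)] K] by linarith
        ultimately have "nrm (restrict_seq F y) > real n"
          using r(2) by linarith
        then show "y \<in> X - E n"
          using y(1) F(1) by (auto simp: E_def not_le)
      qed
      then show "\<exists>r>0. mball x r \<subseteq> X - E n"
        using r(1) by blast
    qed auto
    then show ?thesis
      by (simp add: closedin_def E_def)
  qed
  have cover: "\<Union> (range E) = X"
  proof -
    have "\<exists>n. x \<in> E n" if "x \<in> X" for x
    proof -
      obtain C where "\<forall>F. finite F \<longrightarrow> nrm (restrict_seq F x) \<le> C"
        using subset_sums_bounded[OF uncond \<open>x \<in> X\<close>] by blast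
      moreover obtain n :: nat where "C \<le> real n"
        using real_arch_simple by blast
      ultimately show ?thesis
        using that by (auto simp: E_def intro: order_trans)
    qed
    then show ?thesis
      by (auto simp: E_def)
  qed
  have "\<exists>n. mtopology interior_of E n \<noteq> {}"
  proof (rule ccontr)
    assume "\<not> ?thesis"
    then have "mtopology interior_of \<Union> (range E) = {}"
      using closed by (intro metric_Baire_category_alt complete) auto
    moreover have "mtopology interior_of X = X"
      by (metis interior_of_topspace topspace_mtopology)
    ultimately show False
      using cover zero_in by auto
  qed
  then obtain n x0 T where T: "openin mtopology T" "T \<subseteq> E n" "x0 \<in> T"
    by (auto simp: interior_of_def)
  then obtain r where "r > 0" "mball x0 r \<subseteq> T"
    unfolding openin_mtopology by metis
  with T have r: "r > 0" "mball x0 r \<subseteq> E n" and x0: "x0 \<in> E n"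
    by auto
  have x0_in: "x0 \<in> X"
    using x0 by (simp add: E_def)
  have small: "nrm (restrict_seq F x) \<le> 2 * real n" if "x \<in> X" "nrm x < r" "finite F" for x F
  proof -
    have "nrm (x0 - (x0 - x)) < r"
      using that(2) by simp
    then have "x0 - x \<in> mball x0 r"
      unfolding mem_mball using x0_in diff_in[OF x0_in that(1)] by blast
    then have "x0 - x \<in> E n"
      using r(2) by blast
    then have le: "nrm (restrict_seq F (x0 - x)) \<le> real n" "nrm (restrict_seq F x0) \<le> real n"
      using x0 that(3) by (simp_all add: E_def)
    have eq: "restrict_seq F x = restrict_seq F x0 - restrict_seq F (x0 - x)"
      by (auto simp: restrict_seq_def fun_eq_iff)
    have "nrm (restrict_seq F x) \<le> nrm (restrict_seq F x0) + nrm (restrict_seq F (x0 - x))"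
      unfolding eq using that(3) by (intro nrm_diff_le restrict_seq_in)
    with le show ?thesis
      by linarith
  qed
  have "nrm (restrict_seq F x) / (2 * real n + 1) \<le> 2 / r * nrm x" if "x \<in> X" "finite F" for x F
  proof (rule bounded_of_small[OF r(1) _ _ that(1), where g = "\<lambda>x. nrm (restrict_seq F x) / (2 * real n + 1)"])
    show "nrm (restrict_seq F y) / (2 * real n + 1) < 1" if "y \<in> X" "nrm y < r" for y
      using small[OF that \<open>finite F\<close>] by simp
    fix c :: 'k and y assume "y \<in> X"
    have "restrict_seq F (seq_scale c y) = seq_scale c (restrict_seq F y)"
      by (auto simp: restrict_seq_def seq_scale_def)
    then show "nrm (restrict_seq F (seq_scale c y)) / (2 * real n + 1)
        = norm c * (nrm (restrict_seq F y) / (2 * real n + 1))"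
      using nrm_scale[OF restrict_seq_in[OF \<open>finite F\<close>]] by simp
  qed
  then have "nrm (restrict_seq F x) \<le> (2 / r * (2 * real n + 1)) * nrm x" if "x \<in> X" "finite F" for x F
    using that by (simp add: divide_le_eq mult_ac)
  then show ?thesis
    using r(1) by (intro that[of "2 / r * (2 * real n + 1)"]) auto
qed

text \<open>
  A finite truncation of a sequence in the larger space is also a truncation of one of its partial
  sums. These lie in the original space, where the uniform bound is available.
\<close>

lemma unconditional_multiplier_bound:
  assumes banach: "banach_sequence_space X nrm" and uncond: "unit_seqs_unconditional_basis X nrm"
  obtains D where "D \<ge> 0"
    "\<And>x F a M. x \<in> hat_space nrm \<Longrightarrow> finite F \<Longrightarrow> M \<ge> 0 \<Longrightarrow> (\<And>k. k \<in> F \<Longrightarrow> norm (a k) \<le> M) \<Longrightarrow>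
       nrm (restrict_seq F (\<lambda>k. a k * x k)) \<le> D * M * hat_norm nrm x"
proof -
  obtain C where C: "C \<ge> 0" "\<And>x F. x \<in> X \<Longrightarrow> finite F \<Longrightarrow> nrm (restrict_seq F x) \<le> C * nrm x"
    using unconditional_constant[OF banach uncond] by blast
  show ?thesis
  proof (rule that[of "2 * DIM('k) * C"])
    show "2 * DIM('k) * C \<ge> 0"
      using C(1) by simp
    fix x and F :: "int set" and a and M :: real
    assume x: "x \<in> hat_space nrm" and F: "finite F" and M: "M \<ge> 0"
      and a: "\<And>k. k \<in> F \<Longrightarrow> norm (a k :: 'k) \<le> M"
    let ?f = "\<lambda>k. seq_scale (x k) (unit_seq k)"
    have "nrm (\<Sum>k\<in>F. seq_scale (a k) (?f k)) \<le> 2 * DIM('k) * (M * (C * hat_norm nrm x))"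
    proof (rule nrm_multiplier_le[OF F _ _ a M])
      show "?f k \<in> X" for k
        by (intro scale_in unit_seq_in)
      fix G assume "G \<subseteq> F"
      then have G: "finite G"
        using F finite_subset by blast
      define N where "N = (\<Sum>k\<in>G. nat \<bar>k\<bar>)"
      have "nat \<bar>k\<bar> \<le> N" if "k \<in> G" for k
        unfolding N_def using member_le_sum[OF that, of "\<lambda>k. nat \<bar>k\<bar>"] G by simp
      then have "restrict_seq G x = restrict_seq G (partial_sum x N N)"
        by (force simp: restrict_seq_def partial_sum_apply fun_eq_iff)
      then have "nrm (\<Sum>k\<in>G. ?f k) \<le> C * nrm (partial_sum x N N)"
        using C(2)[OF partial_sum_in G] by (simp add: restrict_seq_eq_sum[OF G])
      also have "\<dots> \<le> C * hat_norm nrm x"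
        using C(1) nrm_partial_sum_le[OF x] by (intro mult_left_mono)
      finally show "nrm (\<Sum>k\<in>G. ?f k) \<le> C * hat_norm nrm x" .
    qed
    moreover have "(\<Sum>k\<in>F. seq_scale (a k) (?f k)) = restrict_seq F (\<lambda>k. a k * x k)"
      unfolding restrict_seq_eq_sum[OF F] by (intro sum.cong) (auto simp: seq_scale_def mult.assoc)
    ultimately show "nrm (restrict_seq F (\<lambda>k. a k * x k)) \<le> 2 * DIM('k) * C * M * hat_norm nrm x"
      by (simp add: mult_ac)
  qed
qed

section \<open>The series condition from hypercyclicity\<close>

text \<open>
  The \<open>p\<close>-th set consists of the times at which the orbit is close to a target supported on
  \<open>{- p..p}\<close>. Relative to the weights, the coefficients of all targets are distinct positive
  integers, at least \<open>p\<close> in the \<open>p\<close>-th one. So the corresponding coefficient of \<open>y\<close> determines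
  \<open>p\<close> and the position within the window around the return time; windows of different return
  times, of the same or of different sets, are disjoint.

  Hence, seen from a return time \<open>m\<close> of the \<open>q\<close>-th set, the indices of the series in question lie
  outside the support of the target, where the shifted orbit is small in norm. The series arises
  from it by division by coefficients of \<open>y\<close>, of modulus at least \<open>p / 2\<close>, and this is where
  bounded multipliers are used.
\<close>

lemma small_series_if_hypercyclic:
  assumes banach: "banach_sequence_space X nrm" and uncond: "unit_seqs_unconditional_basis X nrm"
    and nz: "\<And>n. w n \<noteq> 0"
    and hyp: "hypercyclic_for \<A> (hat_space nrm) (hat_norm nrm) (backward_shift w) X"
  shows "\<exists>\<epsilon>. null_positive \<epsilon> \<and>
    small_series_condition nrm (shift_weights w) \<A> (\<lambda>p. {- int p..int p}) \<epsilon>"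
proof -
  define v where "v = shift_weights w"
  have vnz: "v k \<noteq> 0" for k
    using nz by (simp add: v_def shift_weights_nonzero)
  obtain D where D: "D \<ge> 0"
    "\<And>x F a M. x \<in> hat_space nrm \<Longrightarrow> finite F \<Longrightarrow> M \<ge> 0 \<Longrightarrow> (\<And>k. k \<in> F \<Longrightarrow> norm (a k) \<le> M) \<Longrightarrow>
       nrm (restrict_seq F (\<lambda>k. a k * x k)) \<le> D * M * hat_norm nrm x"
    using unconditional_multiplier_bound[OF banach uncond] by blast
  obtain y where y: "y \<in> hat_space nrm"
    "\<And>U. openin hat.mtopology U \<Longrightarrow> U \<inter> X \<noteq> {} \<Longrightarrow> {n. (backward_shift w ^^ n) y \<in> U} \<in> \<A>"
    using hyp unfolding hypercyclic_for_def by blast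
  define \<eta> where "\<eta> i = y i / v i" for i
  have orbit: "(backward_shift w ^^ n) y k = v k * \<eta> (k + int n)" for n k
    by (simp add: backward_shift_power[OF nz] v_def \<eta>_def)

  define N where "N p k = prod_encode (p, int_encode k)" for p :: nat and k
  have N_inj: "p = q \<and> j = i" if "N p j = N q i" for p q j i
    using that inj_eq[OF inj_int_encode] by (simp add: N_def)
  have N_ge: "p \<le> N p k" for p k
    unfolding N_def by (rule le_prod_encode_1)
  define z where "z p = restrict_seq {- int p..int p} (\<lambda>k. of_nat (N p k) * v k)" for p
  have z_X: "z p \<in> X" for p
    by (simp add: z_def restrict_seq_in)
  have z_hat: "z p \<in> hat_space nrm" for p
    by (rule finite_support_in_hat(1)[of "{- int p..int p}"]) (auto simp: z_def restrict_seq_def)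
  have z_apply: "z p k = (if \<bar>k\<bar> \<le> int p then of_nat (N p k) * v k else 0)" for p k
    by (auto simp: z_def restrict_seq_def)

  \<comment> \<open>Tolerances for which the coefficients in the window are met up to less than 1/2.\<close>
  define \<delta> where "\<delta> p = Min (insert (1 / real (Suc p))
    ((\<lambda>k. norm (v k) * nrm (unit_seq k) / 4) ` {- int p..int p}))" for p
  have \<delta>_pos: "\<delta> p > 0" for p
    unfolding \<delta>_def using vnz nrm_unit_seq_pos by (subst Min_gr_iff) auto
  have \<delta>_le: "\<delta> p \<le> 1 / real (Suc p)" for p
    unfolding \<delta>_def by (intro Min_le) auto
  have \<delta>_le_unit: "4 * \<delta> p \<le> norm (v k) * nrm (unit_seq k)" if "\<bar>k\<bar> \<le> int p" for p k
  proof -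
    have "\<delta> p \<le> norm (v k) * nrm (unit_seq k) / 4"
      unfolding \<delta>_def using that by (intro Min_le insertI2 imageI) auto
    then show ?thesis
      by simp
  qed

  define A where "A p = {n. (backward_shift w ^^ n) y \<in> hat.mball (z p) (\<delta> p)}" for p
  have A_in: "A p \<in> \<A>" for p
    unfolding A_def
  proof (rule y(2)[OF hat.openin_mball])
    have "z p \<in> hat.mball (z p) (\<delta> p)"
      using z_hat \<delta>_pos by simp
    then show "hat.mball (z p) (\<delta> p) \<inter> X \<noteq> {}"
      using z_X by blast
  qed
  have A_near: "z p - (backward_shift w ^^ n) y \<in> hat_space nrm"
    "hat_norm nrm (z p - (backward_shift w ^^ n) y) < \<delta> p" if "n \<in> A p" for n p
    using that hat.diff_in[OF z_hat[of p], of "(backward_shift w ^^ n) y"]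
    unfolding A_def mem_Collect_eq hat.mem_mball by blast+
  have coeff: "norm (of_nat (N p k) - \<eta> (k + int n)) < 1/2" if "n \<in> A p" "\<bar>k\<bar> \<le> int p" for n p k
  proof -
    have val: "(z p - (backward_shift w ^^ n) y) k = (of_nat (N p k) - \<eta> (k + int n)) * v k"
      unfolding seq_diff_apply orbit z_apply using that(2) by (simp add: algebra_simps)
    have "norm (of_nat (N p k) - \<eta> (k + int n)) * (norm (v k) * nrm (unit_seq k))
        = norm ((z p - (backward_shift w ^^ n) y) k) * nrm (unit_seq k)"
      unfolding val norm_mult by simp
    also have "\<dots> \<le> 2 * hat_norm nrm (z p - (backward_shift w ^^ n) y)"
      by (rule hat_coordinate_le[OF A_near(1)[OF that(1)]])
    also have "\<dots> < 2 * \<delta> p"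
      using A_near(2)[OF that(1)] by simp
    also have "\<dots> \<le> 1/2 * (norm (v k) * nrm (unit_seq k))"
      using \<delta>_le_unit[OF that(2)] by simp
    finally show ?thesis
      using vnz[of k] nrm_unit_seq_pos[of k] by (simp add: mult_less_cancel_right)
  qed
  have separate: "p = q \<and> n = m"
    if "n \<in> A p" "m \<in> A q" "\<bar>j\<bar> \<le> int p" "\<bar>i\<bar> \<le> int q" "j + int n = i + int m" for p q n m i j
  proof -
    have "of_int (int (N p j) - int (N q i))
        = (of_nat (N p j) - \<eta> (j + int n)) - (of_nat (N q i) - \<eta> (i + int m))"
      using that(5) by simp
    then have "norm (of_int (int (N p j) - int (N q i)) :: 'k)
        \<le> norm (of_nat (N p j) - \<eta> (j + int n)) + norm (of_nat (N q i) - \<eta> (i + int m))"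
      by (simp only: norm_triangle_ineq4)
    also have "\<dots> < 1"
      using coeff[OF that(1,3)] coeff[OF that(2,4)] by simp
    finally have "\<bar>int (N p j) - int (N q i)\<bar> < 1"
      unfolding norm_of_int by linarith
    then have "N p j = N q i"
      by simp
    from N_inj[OF this] that(5) show ?thesis
      by auto
  qed
  have disj: "disjoint_family_on A {1..}"
    unfolding disjoint_family_on_def using separate[of _ _ _ _ 0 0] by auto

  \<comment> \<open>The series will be bounded by \<open>2 * D / (p * q)\<close>.\<close>
  define \<epsilon> where "\<epsilon> p = (2 * D + 1) / real p" for p
  have \<epsilon>: "null_positive \<epsilon>"
    unfolding null_positive_def \<epsilon>_def using D(1) lim_const_over_n[of "2 * D + 1"] by simp
  have "triple_norm nrm (shifted_series v (A p) m j) < ereal (min (\<epsilon> p) (\<epsilon> q))"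
    if pq: "p \<ge> 1" "q \<ge> 1" and m: "m \<in> A q" and j: "j \<in> {- int p..int p}" for p q m j
  proof -
    define x where "x = z q - (backward_shift w ^^ m) y"
    have x: "x \<in> hat_space nrm" "hat_norm nrm x < \<delta> q"
      unfolding x_def using A_near[OF m] .
    define a where "a i = - (1 / \<eta> (i + int m))" for i
    have "nrm (partial_sum (shifted_series v (A p) m j) k l) \<le> 2 * D * (1 / (real p * real q))" for k l
    proof -
      define F where "F = {i \<in> {- int k..int l}. \<exists>n\<in>A p. n \<noteq> m \<and> i = int n - int m + j}"
      have fin: "finite F"
        by (rule finite_subset[of _ "{- int k..int l}"]) (auto simp: F_def)
      have F: "norm (a i) \<le> 2 / real p" "a i * x i = v i" if i: "i \<in> F" for i
      proof -
        obtain n where n: "n \<in> A p" "n \<noteq> m" "j + int n = i + int m"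
          using i by (auto simp: F_def)
        have jp: "\<bar>j\<bar> \<le> int p"
          using j by auto
        have "\<not> \<bar>i\<bar> \<le> int q"
          using separate[OF n(1) m jp _ n(3)] n(2) by blast
        then have xi: "x i = - (v i * \<eta> (i + int m))"
          unfolding x_def seq_diff_apply orbit z_apply by simp
        have "norm (of_nat (N p j) - \<eta> (i + int m)) < 1/2"
          using coeff[OF n(1) jp] n(3) by simp
        moreover have "norm (of_nat (N p j) :: 'k) \<ge> real p"
          using N_ge[of p j] by simp
        ultimately have "norm (\<eta> (i + int m)) > real p - 1/2"
          using norm_triangle_ineq2[of "of_nat (N p j)" "\<eta> (i + int m)"] by linarith
        then have big: "norm (\<eta> (i + int m)) \<ge> real p / 2" and nonzero: "\<eta> (i + int m) \<noteq> 0"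
          using pq(1) by auto
        show "norm (a i) \<le> 2 / real p"
          using big pq(1) nonzero by (simp add: a_def norm_divide field_simps)
        show "a i * x i = v i"
          using nonzero by (simp add: a_def xi)
      qed
      have "restrict_seq F v = restrict_seq F (\<lambda>i. a i * x i)"
        unfolding restrict_seq_def using F(2) by (auto simp: fun_eq_iff)
      moreover have "partial_sum (shifted_series v (A p) m j) k l = restrict_seq F v"
        by (auto simp: fun_eq_iff partial_sum_apply restrict_seq_def shifted_series_def F_def)
      ultimately have "nrm (partial_sum (shifted_series v (A p) m j) k l)
          = nrm (restrict_seq F (\<lambda>i. a i * x i))"
        by simp
      also have "\<dots> \<le> D * (2 / real p) * hat_norm nrm x"
        using F(1) pq(1) by (intro D(2) x(1) fin) auto
      also have "\<dots> \<le> D * (2 / real p) * (1 / real q)"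
      proof (rule mult_left_mono)
        have "1 / real (Suc q) \<le> 1 / real q"
          using pq(2) by (simp add: field_simps)
        then show "hat_norm nrm x \<le> 1 / real q"
          using x(2) \<delta>_le[of q] by linarith
      qed (use D(1) in simp)
      finally show ?thesis
        by (simp add: mult.commute)
    qed
    then have "triple_norm nrm (shifted_series v (A p) m j) \<le> ereal (2 * D * (1 / (real p * real q)))"
      unfolding triple_norm_le_iff by blast
    also have "\<dots> < ereal (min (\<epsilon> p) (\<epsilon> q))"
    proof -
      have "2 * D * (1 / (real p * real q)) \<le> 2 * D * (1 / real p)"
        "2 * D * (1 / (real p * real q)) \<le> 2 * D * (1 / real q)"
        using pq D(1) by (intro mult_left_mono; simp add: field_simps)+
      moreover have "2 * D * (1 / real p) < \<epsilon> p" "2 * D * (1 / real q) < \<epsilon> q"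
        using pq by (auto simp: \<epsilon>_def field_simps)
      ultimately show ?thesis
        by simp
    qed
    finally show ?thesis .
  qed
  then show ?thesis
    using \<epsilon> A_in disj unfolding small_series_condition_def v_def[symmetric]
    by (intro exI[of _ \<epsilon>] conjI exI[of _ A]) auto
qed

end

section \<open>The characterization\<close>

theorem theorem6:
  fixes X :: "(int \<Rightarrow> 'k::{real_normed_field, euclidean_space}) set"
    and nrm :: "(int \<Rightarrow> 'k) \<Rightarrow> real"
    and w v :: "int \<Rightarrow> 'k"
    and \<A> :: "nat set set"
    and J :: "nat \<Rightarrow> int set"
  assumes "banach_sequence_space X nrm"
    and "unit_seqs_basis X nrm"
    and "\<And>n. w n \<noteq> 0"
    and "operator_on X nrm (backward_shift w)"
    and "furstenberg_family \<A>"
  defines "v \<equiv> shift_weights w"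
    and "J \<equiv> \<lambda>p. {- int p..int p}"
  shows
    "((\<exists>\<epsilon>. null_positive \<epsilon> \<and> small_series_condition nrm v \<A> J \<epsilon>) \<longleftrightarrow>
        (\<forall>\<epsilon>. null_positive \<epsilon> \<longrightarrow> small_series_condition nrm v \<A> J \<epsilon>)) \<and>
     ((\<exists>\<epsilon>. null_positive \<epsilon> \<and> small_series_condition nrm v \<A> J \<epsilon>) \<longrightarrow>
        hypercyclic_for \<A> (hat_space nrm) (hat_norm nrm) (backward_shift w) X) \<and>
     (unit_seqs_unconditional_basis X nrm \<longrightarrow>
        hypercyclic_for \<A> (hat_space nrm) (hat_norm nrm) (backward_shift w) X \<longrightarrow>
        (\<exists>\<epsilon>. null_positive \<epsilon> \<and> small_series_condition nrm v \<A> J \<epsilon>)) \<and>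
     (invertible_operator_on X nrm (backward_shift w) \<longrightarrow>
        ((\<exists>\<epsilon>. null_positive \<epsilon> \<and> small_series_condition nrm v \<A> J \<epsilon>) \<longleftrightarrow>
         (\<exists>\<epsilon>. null_positive \<epsilon> \<and> small_series_condition nrm v \<A> (\<lambda>p. {0}) \<epsilon>)))"
proof -
  have normed: "normed_sequence_space X nrm"
    using assms(1) by (simp add: banach_sequence_space_def)
  have unit_in: "unit_seq n \<in> X" for n
    using assms(2) by (simp add: unit_seqs_basis_def)
  interpret unit_seq_norm X nrm
    by unfold_locales (fact normed unit_in)+
  have J_mono: "J p \<subseteq> J p'" if "p \<le> p'" for p p'
    using that by (auto simp: J_def)
  have any: "\<forall>\<epsilon>. null_positive \<epsilon> \<longrightarrow> small_series_condition nrm v \<A> J \<epsilon>"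
    if "\<exists>\<epsilon>. null_positive \<epsilon> \<and> small_series_condition nrm v \<A> J \<epsilon>"
    using that small_series_condition_any_tolerance[of J, OF J_mono] by blast
  have "null_positive (\<lambda>p. inverse (real (Suc p)))"
    using LIMSEQ_inverse_real_of_nat by (simp add: null_positive_def)
  then have some: "\<exists>\<epsilon>. null_positive \<epsilon> \<and> small_series_condition nrm v \<A> J \<epsilon>"
    if "\<forall>\<epsilon>. null_positive \<epsilon> \<longrightarrow> small_series_condition nrm v \<A> J \<epsilon>"
    using that by blast
  have sufficient: "hypercyclic_for \<A> (hat_space nrm) (hat_norm nrm) (backward_shift w) X"
    if "\<exists>\<epsilon>. null_positive \<epsilon> \<and> small_series_condition nrm v \<A> J \<epsilon>"
    using any[OF that] by (intro hypercyclic_if_small_series assms(2,3,5)) (simp add: v_def J_def)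
  have necessary: "\<exists>\<epsilon>. null_positive \<epsilon> \<and> small_series_condition nrm v \<A> J \<epsilon>"
    if "unit_seqs_unconditional_basis X nrm"
      "hypercyclic_for \<A> (hat_space nrm) (hat_norm nrm) (backward_shift w) X"
    using small_series_if_hypercyclic[OF assms(1) that(1) assms(3) that(2)] by (simp add: v_def J_def)
  have restrict: "\<exists>\<epsilon>. null_positive \<epsilon> \<and> small_series_condition nrm v \<A> (\<lambda>p. {0}) \<epsilon>"
    if "\<exists>\<epsilon>. null_positive \<epsilon> \<and> small_series_condition nrm v \<A> J \<epsilon>"
    using that small_series_condition_mono[of nrm v \<A> J _ "\<lambda>p. {0}"] by (auto simp: J_def)
  have extend: "\<exists>\<epsilon>. null_positive \<epsilon> \<and> small_series_condition nrm v \<A> J \<epsilon>"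
    if "invertible_operator_on X nrm (backward_shift w)"
      "\<exists>\<epsilon>. null_positive \<epsilon> \<and> small_series_condition nrm v \<A> (\<lambda>p. {0}) \<epsilon>"
    using that(2) small_series_condition_if_invertible[OF assms(3) that(1)]
    unfolding v_def J_def by blast
  show ?thesis
    using any some sufficient necessary restrict extend by blast
qed

end
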